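(* Let $G$ be a claw-free graph that is not quasi-line, with $\alpha(G)\ge 4$. If $G$ is facet-defining, then $G$ is ${\rm LS}_+$-imperfect.
   Context: All graphs are finite and simple; $\alpha(G)$ is the stability number. A graph is claw-free if it has no induced $K_{1,3}$; it is quasi-line if the neighborhood of every node can be partitioned into two cliques. ${\rm STAB}(G)$ is the convex hull of incidence vectors of stable sets of $G=(V,E)$; $G$ is facet-defining if ${\rm STAB}(G)$ has a facet with all left-hand-side coefficients nonzero. ${\rm ESTAB}(G)=\{x\in[0,1]^V: x_i+x_j\le1,\ ij\in E\}$. For convex $K\subseteq[0,1]^n$: $\mathrm{cone}(K)=\{(x_0,x): x=x_0y, y\in K\}$; $M_+(K)$ is the set of symmetric positive semidefinite $(n+1)\times(n+1)$ matrices $Y$ (indices $0,\dots,n$) with $Ye_0=\mathrm{diag}(Y)$, $Ye_i\in\mathrm{cone}(K)$, $Y(e_0-e_i)\in\mathrm{cone}(K)$ for $i=1,\dots,n$; ${\rm LS}_+(K)=\{x\in[0,1]^n:(1,x)^T=Ye_0 \text{ for some } Y\in M_+(K)\}$. $G$ is ${\rm LS}_+$-perfect if ${\rm LS}_+({\rm ESTAB}(G))={\rm STAB}(G)$, and ${\rm LS}_+$-imperfect otherwise. *)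

theory Defs
  imports "HOL-Analysis.Analysis"
begin

definition simple_graph :: "('n::finite \<Rightarrow> 'n \<Rightarrow> bool) \<Rightarrow> bool" where
  "simple_graph E \<longleftrightarrow> (\<forall>u v. E u v \<longleftrightarrow> E v u) \<and> (\<forall>v. \<not> E v v)"

definition stable_set :: "('n \<Rightarrow> 'n \<Rightarrow> bool) \<Rightarrow> 'n set \<Rightarrow> bool" where
  "stable_set E S \<longleftrightarrow> (\<forall>u\<in>S. \<forall>v\<in>S. \<not> E u v)"

definition clique :: "('n \<Rightarrow> 'n \<Rightarrow> bool) \<Rightarrow> 'n set \<Rightarrow> bool" where
  "clique E S \<longleftrightarrow> (\<forall>u\<in>S. \<forall>v\<in>S. u \<noteq> v \<longrightarrow> E u v)"

definition stability_number :: "('n::finite \<Rightarrow> 'n \<Rightarrow> bool) \<Rightarrow> nat" where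
  "stability_number E = Max (card ` {S. stable_set E S})"

definition claw_free :: "('n \<Rightarrow> 'n \<Rightarrow> bool) \<Rightarrow> bool" where
  "claw_free E \<longleftrightarrow> \<not> (\<exists>v a b c. a \<noteq> b \<and> a \<noteq> c \<and> b \<noteq> c \<and>
      E v a \<and> E v b \<and> E v c \<and> \<not> E a b \<and> \<not> E a c \<and> \<not> E b c)"

definition neighborhood :: "('n \<Rightarrow> 'n \<Rightarrow> bool) \<Rightarrow> 'n \<Rightarrow> 'n set" where
  "neighborhood E v = {u. E v u}"

definition quasi_line :: "('n \<Rightarrow> 'n \<Rightarrow> bool) \<Rightarrow> bool" where
  "quasi_line E \<longleftrightarrow> (\<forall>v. \<exists>A B. A \<union> B = neighborhood E v \<and> A \<inter> B = {} \<and> clique E A \<and> clique E B)"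

definition incidence_vector :: "'n set \<Rightarrow> real ^ 'n" where
  "incidence_vector S = (\<chi> i. if i \<in> S then 1 else 0)"

definition STAB :: "('n::finite \<Rightarrow> 'n \<Rightarrow> bool) \<Rightarrow> (real ^ 'n) set" where
  "STAB E = convex hull (incidence_vector ` {S. stable_set E S})"

definition ESTAB :: "('n::finite \<Rightarrow> 'n \<Rightarrow> bool) \<Rightarrow> (real ^ 'n) set" where
  "ESTAB E = {x. (\<forall>i. 0 \<le> x $ i \<and> x $ i \<le> 1) \<and> (\<forall>i j. E i j \<longrightarrow> x $ i + x $ j \<le> 1)}"

definition facet_defining :: "('n::finite \<Rightarrow> 'n \<Rightarrow> bool) \<Rightarrow> bool" where
  "facet_defining E \<longleftrightarrow> (\<exists>F a b. F facet_of STAB E \<and> (\<forall>x\<in>STAB E. a \<bullet> x \<le> b) \<and>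
      F = {x \<in> STAB E. a \<bullet> x = b} \<and> (\<forall>i. a $ i \<noteq> 0))"

definition cone_of :: "(real ^ 'n) set \<Rightarrow> (real \<times> (real ^ 'n)) set" where
  "cone_of K = {(x0, x). \<exists>y\<in>K. x = x0 *\<^sub>R y}"

text \<open>Matrices indexed by 0..n are functions on 'n option, with None playing index 0.\<close>
definition psd :: "('n::finite option \<Rightarrow> 'n option \<Rightarrow> real) \<Rightarrow> bool" where
  "psd Y \<longleftrightarrow> (\<forall>i j. Y i j = Y j i) \<and> (\<forall>v. 0 \<le> (\<Sum>i\<in>UNIV. \<Sum>j\<in>UNIV. v i * Y i j * v j))"

definition M_plus :: "(real ^ 'n::finite) set \<Rightarrow> ('n option \<Rightarrow> 'n option \<Rightarrow> real) set" where
  "M_plus K = {Y. psd Y \<and> (\<forall>i. Y i None = Y i i) \<and>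
     (\<forall>i. (Y None (Some i), \<chi> j. Y (Some j) (Some i)) \<in> cone_of K) \<and>
     (\<forall>i. (Y None None - Y None (Some i), \<chi> j. Y (Some j) None - Y (Some j) (Some i)) \<in> cone_of K)}"

definition LS_plus :: "(real ^ 'n::finite) set \<Rightarrow> (real ^ 'n) set" where
  "LS_plus K = {x. (\<forall>i. 0 \<le> x $ i \<and> x $ i \<le> 1) \<and>
     (\<exists>Y\<in>M_plus K. Y None None = 1 \<and> (\<forall>j. Y (Some j) None = x $ j))}"

definition LS_plus_perfect :: "('n::finite \<Rightarrow> 'n \<Rightarrow> bool) \<Rightarrow> bool" where
  "LS_plus_perfect E \<longleftrightarrow> LS_plus (ESTAB E) = STAB E"

end

theory Submission
  imports Defs
begin

text \<open>
  A node whose neighbourhood is not covered by two cliques sees an odd antihole. A facet-defining graph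
  has no clique cutset; together with claw-freeness and a stable set of size four this excludes
  antiholes of length at least seven, so some node is the hub of a 5-wheel.

  If the graph were \<open>LS\<^sub>+\<close>-perfect, it would contain no stretching of the two six-node
  imperfect graphs (a 5-hole plus a node adjacent to three consecutive or to four of its nodes).
  Then a node outside the wheel sees none of the rim, or all of it, or exactly one edge of it. A path of
  nodes away from the rim that connects nodes seeing the rim edges \<open>c0 c1\<close> and \<open>c2 c3\<close> creates such a
  stretching, whatever its parity. Hence each component of nodes not seeing the rim is attached along a
  clique, which would be a clique cutset; so there are none, and what remains has no four
  pairwise nonadjacent nodes.
\<close>

section \<open>Clique cutsets and facets\<close>

text \<open>The connecting paths have unbounded length, so imperfection is needed for infinitely
  many graphs, and no finite list of explicit matrices covers them directly. The way out is that
  replacing coordinates by \<open>x_k\<close>, \<open>x_0 - x_k\<close> or \<open>0\<close> turns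
  lifted matrices into lifted matrices, as long as every edge is sent to a pair of terms with sum at
  most \<open>x_0\<close>. Values alternating between \<open>x_P\<close> and \<open>1 - x_P\<close>
  along a path meet this with equality. One 7 x 7 matrix thus serves every stretching of its graph,
  and the value \<open>0\<close> on all other nodes places the stretching inside the whole graph.
  The violation of the rank inequality is the same for every length. Facets enter only through
  clique cutsets. The empty clique counts as one, so connectedness, on which the treatment of long
  antiholes rests, comes from the same lemma. A stable set of size four is what both ends of the
  argument contradict: long antiholes by counting, 5-wheels by covering with three cliques.\<close>

lemma inner_incidence_vector:
  "a \<bullet> incidence_vector S = (\<Sum>v\<in>S. a $ v)" for a :: "real ^ 'n::finite"
  by (simp add: inner_vec_def incidence_vector_def if_distrib[of "\<lambda>c. _ * c"] sum.If_cases
      cong: if_cong)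

text \<open>A hyperplane containing all incidence vectors passes through the origin because of the
  empty set, and then the singletons force every coefficient to vanish.\<close>

lemma aff_dim_STAB:
  fixes E :: "'n::finite \<Rightarrow> 'n \<Rightarrow> bool"
  assumes "simple_graph E"
  shows "aff_dim (STAB E) = int CARD('n)"
proof (rule ccontr)
  assume n: "aff_dim (STAB E) \<noteq> int CARD('n)"
  then have "aff_dim (STAB E) < int DIM(real ^ 'n)"
    using aff_dim_le_DIM[of "STAB E"] by simp
  then obtain a b where ab: "a \<noteq> 0" "STAB E \<subseteq> {x. a \<bullet> x = b}"
    by (rule aff_lowdim_subset_hyperplane)
  have st: "a \<bullet> incidence_vector S = b" if "stable_set E S" for S
  proof -
    have "incidence_vector S \<in> STAB E"
      unfolding STAB_def using that by (intro hull_inc imageI CollectI)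
    then show ?thesis using ab(2) by blast
  qed
  have "b = 0" using st[of "{}"] by (simp add: stable_set_def inner_incidence_vector)
  moreover have "a $ v = b" for v
    using st[of "{v}"] assms by (simp add: stable_set_def simple_graph_def inner_incidence_vector)
  ultimately show False using ab(1) by (simp add: vec_eq_iff)
qed

text \<open>Complementary slackness: in a convex combination lying on the face, vertices off the
  face have weight zero, so an equation need only be checked on the tight vertices.\<close>

lemma STAB_tight_equation:
  fixes E :: "'n::finite \<Rightarrow> 'n \<Rightarrow> bool"
  assumes valid: "\<And>S. stable_set E S \<Longrightarrow> a \<bullet> incidence_vector S \<le> b"
    and tight: "\<And>S. stable_set E S \<Longrightarrow> a \<bullet> incidence_vector S = b \<Longrightarrow> d \<bullet> incidence_vector S = e"
    and x: "x \<in> STAB E" "a \<bullet> x = b"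
  shows "d \<bullet> x = e"
proof -
  let ?V = "incidence_vector ` {S. stable_set E S}"
  have fin: "finite ?V" by simp
  obtain u where u: "\<forall>v\<in>?V. 0 \<le> u v" "sum u ?V = 1" "(\<Sum>v\<in>?V. u v *\<^sub>R v) = x"
    using x(1) unfolding STAB_def convex_hull_finite[OF fin] by blast
  have lin: "c \<bullet> x - k = (\<Sum>v\<in>?V. u v * (c \<bullet> v - k))" for c k
    using u(2,3) by (auto simp: inner_sum_right right_diff_distrib sum_subtractf simp flip: sum_distrib_right)
  have "(\<Sum>v\<in>?V. u v * (b - a \<bullet> v)) = 0"
    using lin[of a b] x(2) by (simp add: right_diff_distrib sum_subtractf del: mem_Collect_eq)
  moreover have "0 \<le> u v * (b - a \<bullet> v)" if "v \<in> ?V" for v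
    using that u(1) valid by (intro mult_nonneg_nonneg) auto
  ultimately have 0: "u v * (b - a \<bullet> v) = 0" if "v \<in> ?V" for v
    using that sum_nonneg_eq_0_iff[OF fin, of "\<lambda>v. u v * (b - a \<bullet> v)"] by blast
  have "u v * (d \<bullet> v - e) = 0" if v: "v \<in> ?V" for v
  proof (cases "u v = 0")
    case False
    then have "a \<bullet> v = b" using 0[OF v] by simp
    then show ?thesis using v tight by auto
  qed simp
  then have "(\<Sum>v\<in>?V. u v * (d \<bullet> v - e)) = 0" by (rule sum.neutral[rule_format])
  then show ?thesis using lin[of d e] by simp
qed

text \<open>Besides \<open>a \<bullet> x = b\<close>, the tight stable sets satisfy an equation supported on \<open>L \<union> K\<close>: if
  \<open>g k\<close> is the largest weight of a stable set in \<open>L\<close> compatible with \<open>k\<close> and \<open>g0\<close> the largest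
  weight without restriction, then the part of a tight stable set inside \<open>L\<close> must be optimal given
  its at most one node \<open>k\<close> in \<open>K\<close>.\<close>

lemma facet_defining_no_clique_cutset:
  fixes E :: "'n::finite \<Rightarrow> 'n \<Rightarrow> bool"
  assumes G: "simple_graph E" and facet: "facet_defining E" and K: "clique E K"
    and L: "L \<noteq> {}" "L \<inter> K = {}" and R: "L \<union> K \<noteq> UNIV"
    and sep: "\<And>u v. u \<in> L \<Longrightarrow> E u v \<Longrightarrow> v \<in> L \<union> K"
  shows False
proof -
  obtain F a b where F: "F facet_of STAB E" and val: "\<forall>x\<in>STAB E. a \<bullet> x \<le> b"
    and Feq: "F = {x \<in> STAB E. a \<bullet> x = b}" and a: "\<forall>i. a $ i \<noteq> 0"
    using facet unfolding facet_defining_def by blast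
  have symE: "E u v = E v u" and irr: "\<not> E u u" for u v using G by (auto simp: simple_graph_def)
  define w where "w S = (\<Sum>v\<in>S. a $ v)" for S
  have wu: "w (S \<union> T) = w S + w T" if "S \<inter> T = {}" for S T
    unfolding w_def using that by (simp add: sum.union_disjoint)
  have valid: "w S \<le> b" if "stable_set E S" for S
  proof -
    have "incidence_vector S \<in> STAB E"
      unfolding STAB_def using that by (intro hull_inc imageI CollectI)
    then show ?thesis using val by (auto simp: inner_incidence_vector w_def)
  qed
  define C where "C Q = {S. S \<subseteq> L \<and> stable_set E (S \<union> Q)}" for Q
  define g where "g Q = Max (w ` C Q)" for Q
  have g_le: "w S \<le> g Q" if "S \<in> C Q" for S Q
    unfolding g_def using that by (intro Max_ge) auto
  have g_in: "\<exists>S\<in>C Q. w S = g Q" if "C Q \<noteq> {}" for Q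
  proof -
    have "Max (w ` C Q) \<in> w ` C Q" using that by (intro Max_in) auto
    then show ?thesis unfolding g_def by (metis imageE)
  qed
  define d :: "real ^ 'n" where
    "d = (\<chi> v. if v \<in> L then a $ v else if v \<in> K then g {} - g {v} else 0)"
  have tight: "d \<bullet> incidence_vector T = g {}" if T: "stable_set E T" "w T = b" for T
  proof -
    have opt: "w (T \<inter> L) = g (T \<inter> K)"
    proof -
      have TC: "T \<inter> L \<in> C (T \<inter> K)" using T by (auto simp: C_def stable_set_def)
      then obtain S where S: "S \<in> C (T \<inter> K)" "w S = g (T \<inter> K)" using g_in by blast
      \<comment> \<open>Exchange argument: nodes of \<open>L\<close> have neighbours only in
        \<open>L\<close> and \<open>K\<close>, so the part of \<open>T\<close> inside
        \<open>L\<close> may be replaced by any stable set compatible with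
        \<open>T \<inter> K\<close>.\<close>
      have "stable_set E (S \<union> (T - L))"
        using S(1) T(1) sep symE unfolding C_def stable_set_def by blast
      then have "w S + w (T - L) \<le> b"
        using valid wu[of S "T - L"] S(1) by (force simp: C_def)
      moreover have "w T = w (T \<inter> L) + w (T - L)"
        using wu[of "T \<inter> L" "T - L"] by (simp add: Int_Diff_Un Int_Diff_disjoint)
      ultimately show ?thesis using g_le[OF TC] T(2) S(2) by linarith
    qed
    have "d \<bullet> incidence_vector T = (\<Sum>v\<in>T \<inter> L. d $ v) + (\<Sum>v\<in>T - L. d $ v)"
      unfolding inner_incidence_vector by (subst sum.union_disjoint[symmetric]) (auto intro: sum.cong)
    also have "(\<Sum>v\<in>T \<inter> L. d $ v) = w (T \<inter> L)" by (simp add: d_def w_def)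
    also have "(\<Sum>v\<in>T - L. d $ v) = (\<Sum>v\<in>T \<inter> K. g {} - g {v})"
      by (rule sum.mono_neutral_cong_right) (use L in \<open>auto simp: d_def\<close>)
    also have "w (T \<inter> L) + \<dots> = g {}"
    proof (cases "T \<inter> K = {}")
      case True
      then show ?thesis using opt by simp
    next
      case False
      then obtain k where k: "k \<in> T \<inter> K" by blast
      then have "T \<inter> K = {k}"
        using K T(1) by (auto simp: clique_def stable_set_def)
      then show ?thesis using opt by simp
    qed
    finally show ?thesis .
  qed
  have Fd: "F \<subseteq> {x. d \<bullet> x = g {}} \<inter> {x. a \<bullet> x = b}"
  proof
    fix x assume "x \<in> F"
    then have x: "x \<in> STAB E" "a \<bullet> x = b" using Feq by auto
    have "d \<bullet> x = g {}"
      by (rule STAB_tight_equation[OF _ _ x])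
         (use valid tight in \<open>auto simp: inner_incidence_vector w_def\<close>)
    then show "x \<in> {x. d \<bullet> x = g {}} \<inter> {x. a \<bullet> x = b}" using x by simp
  qed
  obtain v where v: "v \<in> L" using L by blast
  then have "d $ v \<noteq> 0" using a by (simp add: d_def)
  then have d0: "d \<noteq> 0" by auto
  obtain r where r: "r \<notin> L" "r \<notin> K" using R by blast
  obtain x0 where x0: "x0 \<in> F" using F by (auto simp: facet_of_def)
  let ?H = "{x. d \<bullet> x = g {}}"
  \<comment> \<open>\<open>d\<close> vanishes at \<open>r\<close> but \<open>a\<close> does not.
    Moving along this axis separates the two hyperplanes, so \<open>F\<close> has codimension at
    least two.\<close>
  have "x0 + axis r 1 \<in> ?H" using x0 Fd r by (auto simp: inner_add_right inner_axis d_def)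
  moreover have "a \<bullet> (x0 + axis r 1) \<noteq> b"
    using x0 Fd a by (auto simp: inner_add_right inner_axis)
  ultimately have "\<not> ?H \<subseteq> {x. a \<bullet> x = b}" by blast
  then have "aff_dim (?H \<inter> {x. a \<bullet> x = b}) = aff_dim ?H - 1"
    using aff_dim_affine_Int_hyperplane[OF affine_hyperplane, of d "g {}" a b] x0 Fd by auto
  also have "\<dots> = int CARD('n) - 2" using aff_dim_hyperplane[OF d0] by simp
  finally have "aff_dim F \<le> int CARD('n) - 2"
    using aff_dim_subset[OF Fd] by simp
  moreover have "aff_dim F = int CARD('n) - 1"
    using F aff_dim_STAB[OF G] by (simp add: facet_of_def)
  ultimately show False by simp
qed

section \<open>Pulling back lifted matrices\<close>

definition edge_cone :: "('k \<Rightarrow> 'k \<Rightarrow> bool) \<Rightarrow> real \<Rightarrow> ('k \<Rightarrow> real) \<Rightarrow> bool" where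
  "edge_cone B x0 x \<longleftrightarrow> (\<forall>k. 0 \<le> x k \<and> x k \<le> x0) \<and> (\<forall>k l. B k l \<longrightarrow> x k + x l \<le> x0)"

lemma edge_cone_add:
  "edge_cone B x0 x \<Longrightarrow> edge_cone B y0 y \<Longrightarrow> edge_cone B (x0 + y0) (\<lambda>k. x k + y k)"
  unfolding edge_cone_def by (smt (verit))

lemma edge_cone_imp_cone_of:
  fixes E :: "'n::finite \<Rightarrow> 'n \<Rightarrow> bool"
  assumes "edge_cone E x0 x"
  shows "(x0, \<chi> j. x j) \<in> cone_of (ESTAB E)"
proof -
  have x0: "0 \<le> x0" using assms unfolding edge_cone_def by (meson order_trans)
  \<comment> \<open>For \<open>x0 = 0\<close> the bounds force \<open>x = 0\<close>, and division by
    zero makes \<open>?y\<close> the zero vector, which is still a point of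
    \<open>ESTAB E\<close>.\<close>
  let ?y = "\<chi> j. x j / x0"
  have "(\<chi> j. x j) = x0 *\<^sub>R ?y"
    using assms unfolding edge_cone_def vec_eq_iff by (cases "x0 = 0") (auto intro: antisym)
  moreover have "?y \<in> ESTAB E"
    using assms x0 unfolding ESTAB_def edge_cone_def
    by (cases "x0 = 0") (auto simp: field_simps simp flip: add_divide_distrib)
  ultimately show ?thesis unfolding cone_of_def by blast
qed

definition edge_matrix :: "('k::finite \<Rightarrow> 'k \<Rightarrow> bool) \<Rightarrow> ('k option \<Rightarrow> 'k option \<Rightarrow> real) \<Rightarrow> bool" where
  "edge_matrix B M \<longleftrightarrow> psd M \<and> M None None = 1 \<and>
     (\<forall>k. M (Some k) None = M (Some k) (Some k)) \<and>
     (\<forall>k. edge_cone B (M None (Some k)) (\<lambda>l. M (Some l) (Some k))) \<and>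
     (\<forall>k. edge_cone B (1 - M None (Some k)) (\<lambda>l. M (Some l) None - M (Some l) (Some k)))"

text \<open>Substituting \<open>0\<close>, \<open>x\<^sub>k\<close> or \<open>x\<^sub>0 - x\<^sub>k\<close> for the coordinates is linear, so it acts on lifted
  matrices as a congruence and preserves positive semidefiniteness for free.\<close>

datatype 'k literal = Zero | Pos 'k | Neg 'k

fun eval_literal :: "'k literal \<Rightarrow> real \<Rightarrow> ('k \<Rightarrow> real) \<Rightarrow> real" where
  "eval_literal Zero x0 x = 0"
| "eval_literal (Pos k) x0 x = x k"
| "eval_literal (Neg k) x0 x = x0 - x k"

text \<open>A sufficient condition for two literals to sum to at most \<open>x0\<close> on the edge
  cone. \<open>Pos k\<close> and \<open>Neg k\<close> sum to exactly \<open>x0\<close>; this is what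
  consecutive nodes of a stretched path use.\<close>

fun compatible :: "('k \<Rightarrow> 'k \<Rightarrow> bool) \<Rightarrow> 'k literal \<Rightarrow> 'k literal \<Rightarrow> bool" where
  "compatible B (Pos k) (Pos l) = B k l"
| "compatible B (Pos k) (Neg l) = (k = l)"
| "compatible B (Neg k) (Pos l) = (k = l)"
| "compatible B (Neg k) (Neg l) = False"
| "compatible B _ _ = True"

lemma edge_cone_eval_literal:
  assumes "edge_cone B x0 x" "\<And>u v. E u v \<Longrightarrow> compatible B (\<sigma> u) (\<sigma> v)"
  shows "edge_cone E x0 (\<lambda>u. eval_literal (\<sigma> u) x0 x)"
proof -
  have x: "0 \<le> x k" "x k \<le> x0" "B k l \<Longrightarrow> x k + x l \<le> x0" for k l
    using assms(1) by (auto simp: edge_cone_def)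
  have x0: "0 \<le> x0" using x(1,2) by (meson order_trans)
  have b: "0 \<le> eval_literal t x0 x \<and> eval_literal t x0 x \<le> x0" for t
    using x x0 by (cases t) auto
  have "compatible B s t \<Longrightarrow> eval_literal s x0 x + eval_literal t x0 x \<le> x0" for s t
    using x b by (cases "(B, s, t)" rule: compatible.cases) auto
  then show ?thesis using b assms(2) by (auto simp: edge_cone_def)
qed

text \<open>The rows of the substitution matrix: each literal as a linear form in \<open>x_0\<close>
  and the \<open>x_k\<close>, with \<open>None\<close> for \<open>x_0\<close> itself.\<close>

fun literal_coeff :: "'k literal option \<Rightarrow> 'k option \<Rightarrow> real" where
  "literal_coeff None i = of_bool (i = None)"
| "literal_coeff (Some Zero) i = 0"
| "literal_coeff (Some (Pos k)) i = of_bool (i = Some k)"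
| "literal_coeff (Some (Neg k)) i = of_bool (i = None) - of_bool (i = Some k)"

lemma sum_literal_coeff_None:
  "(\<Sum>i\<in>UNIV. literal_coeff None i * m (i :: 'k::finite option)) = m None"
  by simp

lemma sum_literal_coeff_Some:
  "(\<Sum>i\<in>UNIV. literal_coeff (Some t) i * m (i :: 'k::finite option)) =
    eval_literal t (m None) (\<lambda>k. m (Some k))"
  by (cases t) (auto simp: left_diff_distrib sum_subtractf)

text \<open>The witness is the congruence \<open>C M C^T\<close> with the rows of \<open>C\<close>
  given by \<open>literal_coeff\<close>. Its column at \<open>v\<close> pulls back a column of
  \<open>M\<close> for a literal \<open>Pos k\<close> and a complementary column for
  \<open>Neg k\<close>; for the complementary columns of the witness the two roles are
  exchanged.\<close>

lemma LS_plus_substitution: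
  fixes E :: "'n::finite \<Rightarrow> 'n \<Rightarrow> bool" and B :: "'k::finite \<Rightarrow> 'k \<Rightarrow> bool"
  assumes M: "edge_matrix B M"
    and comp: "\<And>u v. E u v \<Longrightarrow> compatible B (\<sigma> u) (\<sigma> v)"
  shows "(\<chi> u. eval_literal (\<sigma> u) 1 (\<lambda>k. M (Some k) None)) \<in> LS_plus (ESTAB E)"
proof -
  define c where "c = (\<lambda>u. literal_coeff (map_option \<sigma> u))"
  define Y where "Y u v = (\<Sum>i\<in>UNIV. c u i * (\<Sum>j\<in>UNIV. c v j * M i j))" for u v
  have psdM: "psd M" and M1: "M None None = 1"
    and diag: "\<And>k. M (Some k) None = M (Some k) (Some k)"
    and col: "\<And>k. edge_cone B (M None (Some k)) (\<lambda>l. M (Some l) (Some k))"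
    and cocol: "\<And>k. edge_cone B (1 - M None (Some k)) (\<lambda>l. M (Some l) None - M (Some l) (Some k))"
    using M by (auto simp: edge_matrix_def)
  have symM: "M i j = M j i" for i j using psdM by (auto simp: psd_def)
  \<comment> \<open>Column 0 is the sum of a column and its complement. It is needed where a node is
    sent to \<open>Zero\<close>.\<close>
  have col0: "edge_cone B 1 (\<lambda>l. M (Some l) None)"
    using edge_cone_add[OF col[of undefined] cocol[of undefined]] by simp
  have YN: "Y None v = (\<Sum>j\<in>UNIV. c v j * M None j)" for v
    unfolding Y_def c_def by (simp add: sum_literal_coeff_None)
  have YS: "Y (Some u) v = eval_literal (\<sigma> u) (\<Sum>j\<in>UNIV. c v j * M None j)
      (\<lambda>k. \<Sum>j\<in>UNIV. c v j * M (Some k) j)" for u v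
    unfolding Y_def using sum_literal_coeff_Some by (simp add: c_def)
  have cN: "(\<Sum>j\<in>UNIV. c None j * M i j) = M i None" for i
    unfolding c_def by (simp add: sum_literal_coeff_None)
  have cS: "(\<Sum>j\<in>UNIV. c (Some v) j * M i j) = eval_literal (\<sigma> v) (M i None) (\<lambda>k. M i (Some k))" for i v
    unfolding c_def using sum_literal_coeff_Some[of "\<sigma> v" "M i"] by simp
  have symY: "Y u v = Y v u" for u v
    unfolding Y_def sum_distrib_left
    by (subst sum.swap) (simp add: symM[of _ _] mult.left_commute)
  have psdY: "psd Y"
    unfolding psd_def
  proof (intro conjI allI symY)
    fix w :: "'n option \<Rightarrow> real"
    define W where "W i = (\<Sum>u\<in>UNIV. w u * c u i)" for i
    have "(\<Sum>u\<in>UNIV. \<Sum>v\<in>UNIV. w u * Y u v * w v)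
        = (\<Sum>u\<in>UNIV. \<Sum>v\<in>UNIV. \<Sum>i\<in>UNIV. \<Sum>j\<in>UNIV. w u * c u i * M i j * (w v * c v j))"
      by (simp add: Y_def sum_distrib_left sum_distrib_right mult_ac)
    also have "\<dots> = (\<Sum>u\<in>UNIV. \<Sum>i\<in>UNIV. \<Sum>v\<in>UNIV. \<Sum>j\<in>UNIV. w u * c u i * M i j * (w v * c v j))"
      by (intro sum.cong refl, subst sum.swap) simp
    also have "\<dots> = (\<Sum>i\<in>UNIV. \<Sum>u\<in>UNIV. \<Sum>j\<in>UNIV. \<Sum>v\<in>UNIV. w u * c u i * M i j * (w v * c v j))"
      by (subst sum.swap) (intro sum.cong refl sum.swap)
    also have "\<dots> = (\<Sum>i\<in>UNIV. \<Sum>j\<in>UNIV. \<Sum>u\<in>UNIV. \<Sum>v\<in>UNIV. w u * c u i * M i j * (w v * c v j))"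
      by (intro sum.cong refl sum.swap)
    also have "\<dots> = (\<Sum>i\<in>UNIV. \<Sum>j\<in>UNIV. W i * M i j * W j)"
      by (simp add: W_def sum_distrib_left sum_distrib_right mult_ac)
    finally show "0 \<le> (\<Sum>u\<in>UNIV. \<Sum>v\<in>UNIV. w u * Y u v * w v)"
      using psdM by (simp add: psd_def)
  qed
  have Y00: "Y None None = 1" by (simp add: YN cN M1)
  have Y0: "Y (Some u) None = eval_literal (\<sigma> u) 1 (\<lambda>k. M (Some k) None)" for u
    by (simp add: YS cN M1)
  have Ydiag: "Y (Some u) (Some u) = Y (Some u) None" for u
    unfolding Y0 YS cS cN using M1 diag symM[of None "Some _"] by (cases "\<sigma> u") simp_all
  have zero: "eval_literal t 0 (\<lambda>k. 0) = 0" for t :: "'k literal" by (cases t) auto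
  have Ycol: "edge_cone E (Y None (Some v)) (\<lambda>u. Y (Some u) (Some v))" for v
  proof (cases "\<sigma> v")
    case Zero
    then show ?thesis unfolding YS YN cS
      by (simp add: edge_cone_def zero)
  next
    case (Pos k)
    then show ?thesis unfolding YS YN cS
      using edge_cone_eval_literal[OF col[of k] comp] by simp
  next
    case (Neg k)
    then show ?thesis unfolding YS YN cS
      using edge_cone_eval_literal[OF cocol[of k] comp] by (simp add: M1)
  qed
  have "edge_cone E (Y None None - Y None (Some v)) (\<lambda>u. Y (Some u) None - Y (Some u) (Some v))" for v
  proof -
    have d: "eval_literal t a x - eval_literal t b y = eval_literal t (a - b) (\<lambda>k. x k - y k)"
      for t :: "'k literal" and a b x y by (cases t) auto
    show ?thesis
    proof (cases "\<sigma> v")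
      case Zero
      then show ?thesis unfolding YS YN cS cN d
        using edge_cone_eval_literal[OF col0 comp] by (simp add: M1)
    next
      case (Pos k)
      then show ?thesis unfolding YS YN cS cN d
        using edge_cone_eval_literal[OF cocol[of k] comp] by (simp add: M1)
    next
      case (Neg k)
      then show ?thesis unfolding YS YN cS cN d
        using edge_cone_eval_literal[OF col[of k] comp] by (simp add: M1)
    qed
  qed
  note Ycocol = this
  have "Y u None = Y u u" for u by (cases u) (simp_all only: Ydiag)
  then have "Y \<in> M_plus (ESTAB E)"
    unfolding M_plus_def
    by (intro CollectI conjI allI psdY edge_cone_imp_cone_of Ycol Ycocol)
  moreover have "edge_cone E 1 (\<lambda>u. eval_literal (\<sigma> u) 1 (\<lambda>k. M (Some k) None))"
    by (rule edge_cone_eval_literal[OF col0 comp])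
  ultimately show ?thesis
    unfolding LS_plus_def using Y00 Y0 by (auto simp: edge_cone_def)
qed

section \<open>Rank inequalities and stretched graphs\<close>

lemma STAB_rank_valid:
  fixes E :: "'n::finite \<Rightarrow> 'n \<Rightarrow> bool"
  assumes "\<And>S. stable_set E S \<Longrightarrow> card (S \<inter> U) \<le> r" "x \<in> STAB E"
  shows "(\<Sum>u\<in>U. x $ u) \<le> real r"
proof -
  let ?a = "(\<chi> u. of_bool (u \<in> U)) :: real ^ 'n"
  have a: "?a \<bullet> x = (\<Sum>u\<in>U. x $ u)" for x :: "real ^ 'n"
    by (simp add: inner_vec_def sum.If_cases of_bool_def if_distrib[of "\<lambda>c. c * _"] cong: if_cong)
  have "STAB E \<subseteq> {x. ?a \<bullet> x \<le> real r}"
    unfolding STAB_def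
  proof (rule hull_minimal)
    show "convex {x. ?a \<bullet> x \<le> real r}" by (rule convex_halfspace_le)
    show "incidence_vector ` {S. stable_set E S} \<subseteq> {x. ?a \<bullet> x \<le> real r}"
      unfolding a using assms(1) by (auto simp: incidence_vector_def sum.If_cases Int_commute)
  qed
  then show ?thesis using assms(2) a by auto
qed

text \<open>Dropping one end of \<open>0, ..., 2 * q\<close> leaves \<open>q\<close> pairs of
  consecutive numbers, each met at most once: \<open>{2 i + 1, 2 i + 2}\<close> without
  \<open>0\<close>, and \<open>{2 i, 2 i + 1}\<close> without \<open>2 * q\<close>.\<close>

lemma card_no_consecutive:
  fixes I :: "nat set"
  assumes I: "I \<subseteq> {..2 * q}" and nc: "\<And>i. i \<in> I \<Longrightarrow> Suc i \<notin> I"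
  shows "card I \<le> Suc q" and "0 \<notin> I \<or> 2 * q \<notin> I \<Longrightarrow> card I \<le> q"
proof -
  have small: "card J \<le> q" if "J \<subseteq> I" "0 \<notin> J" for J
  proof -
    have "inj_on (\<lambda>i. (i - 1) div 2) J"
    proof (rule inj_onI)
      fix i j assume ij: "i \<in> J" "j \<in> J" "(i - 1) div 2 = (j - 1) div 2"
      moreover have "i \<noteq> 0" "j \<noteq> 0" using ij that by (metis)+
      ultimately have "i = j \<or> i = Suc j \<or> j = Suc i" by presburger
      then show "i = j" using nc ij that by blast
    qed
    moreover have "(\<lambda>i. (i - 1) div 2) ` J \<subseteq> {..<q}"
    proof clarify
      fix i assume "i \<in> J"
      then have "i \<noteq> 0" "i \<le> 2 * q" using that I by (metis, auto)
      then show "(i - 1) div 2 < q" by presburger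
    qed
    ultimately show ?thesis
      using card_inj_on_le[of "\<lambda>i. (i - 1) div 2" J "{..<q}"] by simp
  qed
  have fin: "finite I" using I finite_subset by blast
  show "card I \<le> Suc q"
    using small[of "I - {0}"] fin card_Diff_singleton_if[of I 0] by (auto split: if_splits)
  show "card I \<le> q" if "0 \<notin> I \<or> 2 * q \<notin> I"
  proof (cases "0 \<in> I")
    case False
    then show ?thesis using small by blast
  next
    case True
    then have q: "2 * q \<notin> I" using that by simp
    have "inj_on (\<lambda>i. i div 2) I"
    proof (rule inj_onI)
      fix i j assume ij: "i \<in> I" "j \<in> I" "i div 2 = j div 2"
      then have "i = j \<or> i = Suc j \<or> j = Suc i" by presburger
      then show "i = j" using nc ij by blast
    qed
    moreover have "(\<lambda>i. i div 2) ` I \<subseteq> {..<q}"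
    proof clarify
      fix i assume "i \<in> I"
      then have "i \<noteq> 2 * q" "i \<le> 2 * q" using q I by auto
      then show "i div 2 < q" by presburger
    qed
    ultimately show ?thesis
      using card_inj_on_le[of "\<lambda>i. i div 2" I "{..<q}"] by simp
  qed
qed

lemma sum_alternating:
  "(\<Sum>i\<le>2 * q. if even i then a else 1 - a) = a + (of_nat q :: real)"
  by (induction q) auto

text \<open>\<open>E\<close> contains an induced copy of \<open>B\<close> in which the node \<open>P\<close> is stretched to the path
  \<open>f 0, \<dots>, f (2 q)\<close>: \<open>f 0\<close> takes over the neighbours \<open>L\<close> of \<open>P\<close> and \<open>f (2 q)\<close> the neighbours \<open>R\<close>. The
  even nodes of the path get the value \<open>x\<^sub>P\<close> and the odd ones \<open>1 - x\<^sub>P\<close>, so both the violation and the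
  bound of the rank inequality are shifted by \<open>q\<close>.\<close>

theorem LS_plus_imperfect_stretch:
  fixes E :: "'n::finite \<Rightarrow> 'n \<Rightarrow> bool" and B :: "'k::finite \<Rightarrow> 'k \<Rightarrow> bool"
    and f :: "nat \<Rightarrow> 'n" and g :: "'k \<Rightarrow> 'n"
  assumes M: "edge_matrix B M"
    and rank: "\<And>S. stable_set B S \<Longrightarrow> card S \<le> r"
    and big: "real r < (\<Sum>k\<in>UNIV. M (Some k) None)"
    and symE: "\<And>u v. E u v \<Longrightarrow> E v u" and B: "simple_graph B"
    and injf: "inj_on f {..2 * q}" and injg: "inj_on g (- {P})"
    and disj: "\<And>i k. i \<le> 2 * q \<Longrightarrow> k \<noteq> P \<Longrightarrow> f i \<noteq> g k"
    and gg: "\<And>k l. k \<noteq> P \<Longrightarrow> l \<noteq> P \<Longrightarrow> E (g k) (g l) \<longleftrightarrow> B k l"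
    and ff: "\<And>i j. i \<le> 2 * q \<Longrightarrow> j \<le> 2 * q \<Longrightarrow> E (f i) (f j) \<longleftrightarrow> i = Suc j \<or> j = Suc i"
    and gf: "\<And>k i. k \<noteq> P \<Longrightarrow> i \<le> 2 * q \<Longrightarrow>
        E (g k) (f i) \<longleftrightarrow> (i = 0 \<and> L k) \<or> (i = 2 * q \<and> R k)"
    and BP: "\<And>k. k \<noteq> P \<Longrightarrow> B k P \<longleftrightarrow> L k \<or> R k"
  shows "\<not> LS_plus_perfect E"
proof
  assume perf: "LS_plus_perfect E"
  let ?I = "{..2 * q}"
  \<comment> \<open>Both ends of the path have even index and hence the literal
    \<open>Pos P\<close>, so edges leaving the path are edges of \<open>B\<close> at
    \<open>P\<close>.\<close>
  define \<sigma> where "\<sigma> u = (if u \<in> f ` ?I then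
      (if even (inv_into ?I f u) then Pos P else Neg P)
    else if u \<in> g ` (- {P}) then Pos (inv_into (- {P}) g u) else Zero)" for u
  have sf: "\<sigma> (f i) = (if even i then Pos P else Neg P)" if "i \<le> 2 * q" for i
    using that injf by (simp add: \<sigma>_def inv_into_f_f)
  have sg: "\<sigma> (g k) = Pos k" if "k \<noteq> P" for k
  proof -
    have "g k \<notin> f ` ?I" using disj[of _ k] that by fastforce
    then show ?thesis using that injg by (auto simp: \<sigma>_def inv_into_f_f)
  qed
  have s0: "\<sigma> u = Zero" if "u \<notin> f ` ?I" "u \<notin> g ` (- {P})" for u
    using that by (simp add: \<sigma>_def)
  have symB: "B k l = B l k" and irrB: "\<not> B k k" for k l
    using B by (auto simp: simple_graph_def)
  have gf': "compatible B (Pos k) (\<sigma> (f i))" if "k \<noteq> P" "i \<le> 2 * q" "E (g k) (f i)" for k i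
    using that gf[of k i] BP[of k] sf[of i] by auto
  have comp: "compatible B (\<sigma> u) (\<sigma> v)" if uv: "E u v" for u v
  proof -
    have com: "compatible B s t = compatible B t s" for s t
      by (cases "(B, s, t)" rule: compatible.cases) (auto simp: symB)
    consider "\<sigma> u = Zero" | "\<sigma> v = Zero"
      | i j where "i \<le> 2 * q" "j \<le> 2 * q" "u = f i" "v = f j"
      | i k where "i \<le> 2 * q" "k \<noteq> P" "u = f i" "v = g k"
      | i k where "i \<le> 2 * q" "k \<noteq> P" "v = f i" "u = g k"
      | k l where "k \<noteq> P" "l \<noteq> P" "u = g k" "v = g l"
      using s0[of u] s0[of v] by blast
    then show ?thesis
    proof cases
      case 1 then show ?thesis by simp
    next
      case 2 then show ?thesis by (cases "\<sigma> u") simp_all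
    next
      case (3 i j)
      then have "i = Suc j \<or> j = Suc i" using ff uv by blast
      then show ?thesis using 3 by (auto simp: sf)
    next
      case (4 i k)
      then show ?thesis using gf'[of k i] symE[OF uv] sg com by simp
    next
      case (5 i k)
      then show ?thesis using gf'[of k i] uv sg by simp
    next
      case (6 k l)
      then show ?thesis using gg uv sg by simp
    qed
  qed
  define x :: "real ^ 'n" where "x = (\<chi> u. eval_literal (\<sigma> u) 1 (\<lambda>k. M (Some k) None))"
  have "x \<in> LS_plus (ESTAB E)" unfolding x_def by (rule LS_plus_substitution[OF M comp])
  then have x: "x \<in> STAB E" using perf by (simp add: LS_plus_perfect_def)
  define U where "U = f ` ?I \<union> g ` (- {P})"
  have dj: "f ` ?I \<inter> g ` (- {P}) = {}" using disj by fastforce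
  have "(\<Sum>u\<in>U. x $ u) = (\<Sum>u\<in>f ` ?I. x $ u) + (\<Sum>u\<in>g ` (- {P}). x $ u)"
    unfolding U_def by (rule sum.union_disjoint) (use dj in auto)
  also have "(\<Sum>u\<in>f ` ?I. x $ u) = (\<Sum>i\<le>2 * q. if even i then M (Some P) None else 1 - M (Some P) None)"
    using injf by (auto simp: sum.reindex x_def sf intro!: sum.cong)
  also have "\<dots> = M (Some P) None + real q" by (rule sum_alternating)
  also have "(\<Sum>u\<in>g ` (- {P}). x $ u) = (\<Sum>k\<in>- {P}. M (Some k) None)"
    using injg by (auto simp: sum.reindex x_def sg intro!: sum.cong)
  also have "M (Some P) None + real q + \<dots> = (\<Sum>k\<in>UNIV. M (Some k) None) + real q"
    by (subst sum.remove[of UNIV P]) (auto simp: Compl_eq_Diff_UNIV)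
  finally have "real (r + q) < (\<Sum>u\<in>U. x $ u)" using big by simp
  moreover have "(\<Sum>u\<in>U. x $ u) \<le> real (r + q)"
  proof (rule STAB_rank_valid[OF _ x])
    fix S assume S: "stable_set E S"
    define I where "I = {i \<in> ?I. f i \<in> S}"
    define T where "T = {k \<in> - {P}. g k \<in> S}"
    have "S \<inter> U = f ` I \<union> g ` T" by (auto simp: I_def T_def U_def)
    then have "card (S \<inter> U) \<le> card (f ` I) + card (g ` T)" using card_Un_le by simp
    also have "\<dots> \<le> card I + card T"
      by (intro add_mono card_image_le) (auto simp: I_def)
    finally have c: "card (S \<inter> U) \<le> card I + card T" .
    have nc: "Suc i \<notin> I" if "i \<in> I" for i
      using that S ff[of i "Suc i"] by (auto simp: I_def stable_set_def)
    have I: "I \<subseteq> ?I" by (auto simp: I_def)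
    have stT: "stable_set B T" using S gg by (auto simp: T_def stable_set_def)
    show "card (S \<inter> U) \<le> r + q"
    \<comment> \<open>Only with both ends in \<open>S\<close> can the path contribute
      \<open>q + 1\<close> nodes. But then \<open>T\<close> misses all neighbours of
      \<open>P\<close>, so \<open>insert P T\<close> is stable in \<open>B\<close> and
      \<open>T\<close> loses one node in exchange.\<close>
    proof (cases "0 \<in> I \<and> 2 * q \<in> I")
      case False
      then show ?thesis
        using card_no_consecutive(2)[OF I nc] rank[OF stT] c by fastforce
    next
      case True
      have "\<not> B k P" if "k \<in> T" for k
        using that True S gf[of k 0] gf[of k "2 * q"] BP[of k]
        by (auto simp: T_def I_def stable_set_def)
      then have "stable_set B (insert P T)"
        using stT symB irrB by (auto simp: stable_set_def)
      then have "Suc (card T) \<le> r" using rank by (fastforce simp: T_def)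
      then show ?thesis using card_no_consecutive(1)[OF I nc] c by linarith
    qed
  qed
  ultimately show False by linarith
qed

section \<open>Two imperfect graphs on six nodes\<close>

text \<open>\<open>NP\<close> is the node to be stretched: the hole node of degree two away from
  \<open>N4\<close> in \<open>LT_graph\<close>, the extra node of degree four in
  \<open>EMN_graph\<close>.\<close>

datatype node = N0 | N1 | N2 | N3 | N4 | NP

lemma UNIV_node: "UNIV = {N0, N1, N2, N3, N4, NP}"
  by (auto intro: node.exhaust)

instance node :: finite
  by standard (simp add: UNIV_node)

lemma all_node: "(\<forall>k. Q k) \<longleftrightarrow> Q N0 \<and> Q N1 \<and> Q N2 \<and> Q N3 \<and> Q N4 \<and> Q NP"
  by (metis node.exhaust)

fun node_index :: "node option \<Rightarrow> nat" where
  "node_index None = 0"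
| "node_index (Some N0) = 1"
| "node_index (Some N1) = 2"
| "node_index (Some N2) = 3"
| "node_index (Some N3) = 4"
| "node_index (Some N4) = 5"
| "node_index (Some NP) = 6"

text \<open>Reduces semidefiniteness of an explicit matrix to an entrywise check of a sum-of-squares
  certificate.\<close>

lemma psd_sum_rank_one:
  fixes Y :: "'k::finite option \<Rightarrow> 'k option \<Rightarrow> real"
  assumes Y: "\<forall>i j. Y i j = (\<Sum>(d, u)\<leftarrow>L. d * u i * u j)" and d: "\<forall>(d, u)\<in>set L. 0 \<le> d"
  shows "psd Y"
  unfolding psd_def
proof (intro conjI allI)
  show "Y i j = Y j i" for i j by (simp add: Y mult_ac)
  fix v :: "'k option \<Rightarrow> real"
  have "(\<Sum>i\<in>UNIV. \<Sum>j\<in>UNIV. v i * (\<Sum>(d, u)\<leftarrow>L. d * u i * u j) * v j) =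
      (\<Sum>(d, u)\<leftarrow>L. d * (\<Sum>i\<in>UNIV. u i * v i)\<^sup>2)"
  proof (induction L)
    case (Cons p L)
    obtain d u where p: "p = (d, u)" by fastforce
    have "(\<Sum>i\<in>UNIV. \<Sum>j\<in>UNIV. v i * (d * u i * u j) * v j) = d * (\<Sum>i\<in>UNIV. u i * v i)\<^sup>2"
      by (simp add: power2_eq_square sum_product sum_distrib_left mult_ac)
    then show ?case using Cons by (simp add: p distrib_left distrib_right sum.distrib)
  qed simp
  moreover have "0 \<le> (\<Sum>(d, u)\<leftarrow>L. d * (\<Sum>i\<in>UNIV. u i * v i)\<^sup>2)"
    by (intro sum_list_nonneg) (use d in auto)
  ultimately show "0 \<le> (\<Sum>i\<in>UNIV. \<Sum>j\<in>UNIV. v i * Y i j * v j)" by (simp add: Y)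
qed

definition row_form :: "real list \<Rightarrow> node option \<Rightarrow> real" where
  "row_form r i = r ! node_index i"

text \<open>The graph of Liptak and Tuncel: the 5-hole \<open>N0 N1 N2 NP N3\<close> and a node \<open>N4\<close> adjacent to three
  consecutive nodes of it.\<close>

definition LT_graph :: "node \<Rightarrow> node \<Rightarrow> bool" where
  "LT_graph k l \<longleftrightarrow> {k, l} \<in> {{N0, N1}, {N1, N2}, {N2, NP}, {NP, N3}, {N3, N0}, {N4, N0}, {N4, N1}, {N4, N2}}"

lemma edge_cone_LT:
  "edge_cone LT_graph x0 x \<longleftrightarrow> (\<forall>k. 0 \<le> x k \<and> x k \<le> x0) \<and>
     x N0 + x N1 \<le> x0 \<and>
     x N1 + x N2 \<le> x0 \<and>
     x N2 + x NP \<le> x0 \<and>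
     x NP + x N3 \<le> x0 \<and>
     x N3 + x N0 \<le> x0 \<and>
     x N4 + x N0 \<le> x0 \<and>
     x N4 + x N1 \<le> x0 \<and>
     x N4 + x N2 \<le> x0"
  unfolding edge_cone_def LT_graph_def insert_iff empty_iff doubleton_eq_iff by (smt (verit))

text \<open>Invariant under the automorphisms of the graph: the exchange of \<open>N1\<close> and
  \<open>N4\<close>, and the reflection exchanging \<open>N0\<close> with \<open>N2\<close> and
  \<open>N3\<close> with \<open>NP\<close>. The matrix is singular, so six squares suffice
  below.\<close>

definition LT_matrix :: "node option \<Rightarrow> node option \<Rightarrow> real" where
  "LT_matrix i j =
    [[62, 36, 6, 36, 21, 6, 21],
     [36, 36, 0, 18, 0, 0, 18],
     [6, 0, 6, 0, 3, 0, 3],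
     [36, 18, 0, 36, 18, 0, 0],
     [21, 0, 3, 18, 21, 3, 0],
     [6, 0, 0, 0, 3, 6, 3],
     [21, 18, 3, 0, 0, 3, 21]] ! node_index i ! node_index j / 62"

lemma edge_matrix_LT: "edge_matrix LT_graph LT_matrix"
proof -
  \<comment> \<open>\<open>LDL\<^sup>T\<close> factorisation\<close>
  let ?L = "[(1/3844 :: real, row_form [62, 36, 6, 36, 21, 6, 21]),
        (9/24986, row_form [0, 26, -6, -5, -21, -6, 10]),
        (3/4030, row_form [0, 0, 10, -9, -4, -3, 5]),
        (3/620, row_form [0, 0, 0, 6, 1, -3, -5]),
        (3/248, row_form [0, 0, 0, 0, 2, -1, 0]),
        (3/248, row_form [0, 0, 0, 0, 0, 1, -2])]"
  have "\<forall>i j. LT_matrix i j = (\<Sum>(d, u)\<leftarrow>?L. d * u i * u j)"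
    unfolding split_option_all all_node by (simp add: LT_matrix_def row_form_def)
  moreover have "\<forall>(d, u)\<in>set ?L. 0 \<le> d" by simp
  ultimately have "psd LT_matrix" by (rule psd_sum_rank_one)
  moreover have "edge_cone LT_graph (LT_matrix None (Some k)) (\<lambda>l. LT_matrix (Some l) (Some k))" for k
    unfolding edge_cone_LT by (cases k) (simp_all add: all_node LT_matrix_def)
  moreover have "edge_cone LT_graph (1 - LT_matrix None (Some k))
      (\<lambda>l. LT_matrix (Some l) None - LT_matrix (Some l) (Some k))" for k
    unfolding edge_cone_LT by (cases k) (simp_all add: all_node LT_matrix_def)
  moreover have "LT_matrix (Some k) None = LT_matrix (Some k) (Some k)" for k
    by (cases k) (simp_all add: LT_matrix_def)
  moreover have "LT_matrix None None = 1" by (simp add: LT_matrix_def)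
  ultimately show ?thesis unfolding edge_matrix_def by blast
qed

text \<open>The 5-hole \<open>N0 N1 N2 N3 N4\<close> and a node \<open>NP\<close> adjacent to four nodes of it.\<close>

definition EMN_graph :: "node \<Rightarrow> node \<Rightarrow> bool" where
  "EMN_graph k l \<longleftrightarrow> {k, l} \<in> {{N0, N1}, {N1, N2}, {N2, N3}, {N3, N4}, {N4, N0}, {NP, N0}, {NP, N1}, {NP, N2}, {NP, N3}}"

lemma edge_cone_EMN:
  "edge_cone EMN_graph x0 x \<longleftrightarrow> (\<forall>k. 0 \<le> x k \<and> x k \<le> x0) \<and>
     x N0 + x N1 \<le> x0 \<and>
     x N1 + x N2 \<le> x0 \<and>
     x N2 + x N3 \<le> x0 \<and>
     x N3 + x N4 \<le> x0 \<and>
     x N4 + x N0 \<le> x0 \<and>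
     x NP + x N0 \<le> x0 \<and>
     x NP + x N1 \<le> x0 \<and>
     x NP + x N2 \<le> x0 \<and>
     x NP + x N3 \<le> x0"
  unfolding edge_cone_def EMN_graph_def insert_iff empty_iff doubleton_eq_iff by (smt (verit))

text \<open>Invariant under the reflection exchanging \<open>N0\<close> with \<open>N3\<close> and
  \<open>N1\<close> with \<open>N2\<close>.\<close>

definition EMN_matrix :: "node option \<Rightarrow> node option \<Rightarrow> real" where
  "EMN_matrix i j =
    [[88, 33, 29, 29, 33, 41, 12],
     [33, 33, 0, 13, 20, 0, 0],
     [29, 0, 29, 0, 13, 16, 0],
     [29, 13, 0, 29, 0, 16, 0],
     [33, 20, 13, 0, 33, 0, 0],
     [41, 0, 16, 16, 0, 41, 12],
     [12, 0, 0, 0, 0, 12, 12]] ! node_index i ! node_index j / 88"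

lemma edge_matrix_EMN: "edge_matrix EMN_graph EMN_matrix"
proof -
  \<comment> \<open>Again an \<open>LDL^T\<close> factorisation, with rows scaled to integers: each
    vector vanishes before its pivot.\<close>
  let ?L = "[(1/7744 :: real, row_form [88, 33, 29, 29, 33, 41, 12]),
        (1/116160, row_form [0, 165, -87, 17, 61, -123, -36]),
        (1/3649360, row_form [0, 0, 754, -464, 338, -309, -348]),
        (1/14204190, row_form [0, 0, 0, 1505, -845, 66, -792]),
        (13/85648948, row_form [0, 0, 0, 0, 892, -573, -348]),
        (1/1628595760, row_form [0, 0, 0, 0, 0, 8299, -4188]),
        (21/182578, row_form [0, 0, 0, 0, 0, 0, 1])]"
  have "\<forall>i j. EMN_matrix i j = (\<Sum>(d, u)\<leftarrow>?L. d * u i * u j)"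
    unfolding split_option_all all_node by (simp add: EMN_matrix_def row_form_def)
  moreover have "\<forall>(d, u)\<in>set ?L. 0 \<le> d" by simp
  ultimately have "psd EMN_matrix" by (rule psd_sum_rank_one)
  moreover have "edge_cone EMN_graph (EMN_matrix None (Some k)) (\<lambda>l. EMN_matrix (Some l) (Some k))" for k
    unfolding edge_cone_EMN by (cases k) (simp_all add: all_node EMN_matrix_def)
  moreover have "edge_cone EMN_graph (1 - EMN_matrix None (Some k))
      (\<lambda>l. EMN_matrix (Some l) None - EMN_matrix (Some l) (Some k))" for k
    unfolding edge_cone_EMN by (cases k) (simp_all add: all_node EMN_matrix_def)
  moreover have "EMN_matrix (Some k) None = EMN_matrix (Some k) (Some k)" for k
    by (cases k) (simp_all add: EMN_matrix_def)
  moreover have "EMN_matrix None None = 1" by (simp add: EMN_matrix_def)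
  ultimately show ?thesis unfolding edge_matrix_def by blast
qed

lemma simple_graph_LT: "simple_graph LT_graph" and simple_graph_EMN: "simple_graph EMN_graph"
  unfolding simple_graph_def all_node by (simp_all add: LT_graph_def EMN_graph_def doubleton_eq_iff)


lemma sum_node:
  "(\<Sum>k\<in>UNIV. h k) = (h N0 + h N1 + h N2 + h N3 + h N4 + h NP :: real)"
  by (simp add: UNIV_node add_ac)

lemma card_le_2_of_no_triple:
  assumes "\<And>a b c. a \<in> S \<Longrightarrow> b \<in> S \<Longrightarrow> c \<in> S \<Longrightarrow> a \<noteq> b \<Longrightarrow> a \<noteq> c \<Longrightarrow> b \<noteq> c \<Longrightarrow> False"
  shows "card S \<le> 2"
proof (rule ccontr)
  assume "\<not> card S \<le> 2"
  then have "3 \<le> card S" by simp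
  then obtain T where "T \<subseteq> S" "card T = 3"
    by (meson obtain_subset_with_card_n)
  then obtain a b c where "{a, b, c} \<subseteq> S" "a \<noteq> b" "a \<noteq> c" "b \<noteq> c"
    unfolding card_3_iff by blast
  then show False using assms[of a b c] by blast
qed

lemma card_stable_set_LT: "stable_set LT_graph S \<Longrightarrow> card S \<le> 2"
proof (rule card_le_2_of_no_triple)
  have "\<forall>a b c. a \<noteq> b \<longrightarrow> a \<noteq> c \<longrightarrow> b \<noteq> c \<longrightarrow> LT_graph a b \<or> LT_graph a c \<or> LT_graph b c"
    unfolding all_node by (simp add: LT_graph_def doubleton_eq_iff)
  then show False if "stable_set LT_graph S" "a \<in> S" "b \<in> S" "c \<in> S" "a \<noteq> b" "a \<noteq> c" "b \<noteq> c" for a b c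
    using that unfolding stable_set_def by blast
qed

lemma card_stable_set_EMN: "stable_set EMN_graph S \<Longrightarrow> card S \<le> 2"
proof (rule card_le_2_of_no_triple)
  have "\<forall>a b c. a \<noteq> b \<longrightarrow> a \<noteq> c \<longrightarrow> b \<noteq> c \<longrightarrow> EMN_graph a b \<or> EMN_graph a c \<or> EMN_graph b c"
    unfolding all_node by (simp add: EMN_graph_def doubleton_eq_iff)
  then show False if "stable_set EMN_graph S" "a \<in> S" "b \<in> S" "c \<in> S" "a \<noteq> b" "a \<noteq> c" "b \<noteq> c" for a b c
    using that unfolding stable_set_def by blast
qed


text \<open>The sums are 126/62 and 177/88, just above the stability number two of both
  graphs.\<close>

lemma rank_violation:
  "(2 :: real) < (\<Sum>k\<in>UNIV. LT_matrix (Some k) None)"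
  "(2 :: real) < (\<Sum>k\<in>UNIV. EMN_matrix (Some k) None)"
  by (simp_all add: sum_node LT_matrix_def EMN_matrix_def)

section \<open>Odd antiholes in neighbourhoods\<close>

text \<open>The periodic continuation to all indices lets later arguments start a walk anywhere
  without arithmetic modulo \<open>n\<close>.\<close>

definition closed_walk :: "('a \<Rightarrow> 'a \<Rightarrow> bool) \<Rightarrow> nat \<Rightarrow> (nat \<Rightarrow> 'a) \<Rightarrow> bool" where
  "closed_walk R n h \<longleftrightarrow> (\<forall>a. h (a + n) = h a) \<and> (\<forall>a. R (h a) (h (Suc a)))"

lemma closed_walk_mod:
  assumes "0 < m" "\<And>i. Suc i < m \<Longrightarrow> R (g i) (g (Suc i))" "R (g (m - 1)) (g 0)"
  shows "closed_walk R m (\<lambda>k. g (k mod m))"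
  unfolding closed_walk_def
proof (intro conjI allI)
  fix a
  show "g ((a + m) mod m) = g (a mod m)" by simp
  show "R (g (a mod m)) (g (Suc a mod m))"
  proof (cases "Suc (a mod m) = m")
    case True
    then have "a mod m = m - 1" by simp
    then show ?thesis using assms(3) True by (simp add: mod_Suc)
  next
    case False
    then have "Suc (a mod m) < m" using assms(1) by (simp add: Suc_lessI)
    then show ?thesis using assms(2) False by (simp add: mod_Suc)
  qed
qed

text \<open>Colour by the parity of walks from a representative of the component; two walks of
  different parity to the same node would close up to an odd one.\<close>

lemma two_colouring:
  assumes sym: "\<And>x y. R x y \<Longrightarrow> R y x"
    and odd: "\<And>n h. odd n \<Longrightarrow> \<not> closed_walk R n h"
  shows "\<exists>A. \<forall>x y. R x y \<longrightarrow> (x \<in> A \<longleftrightarrow> y \<notin> A)"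
proof -
  define r where "r = {(x, y). R x y}"
  have symr: "(y, x) \<in> r ^^ n" if "(x, y) \<in> r ^^ n" for x y n
    using that
  proof (induction n arbitrary: y)
    case (Suc n)
    then obtain z where "(x, z) \<in> r ^^ n" "(z, y) \<in> r" by auto
    then show ?case using Suc.IH sym by (intro relpow_Suc_I2[of y z]) (auto simp: r_def)
  qed simp
  have even: "even n" if "(x, x) \<in> r ^^ n" for x n
  proof (rule ccontr)
    assume n: "odd n"
    have "\<exists>f. f 0 = x \<and> f n = x \<and> (\<forall>i<n. R (f i) (f (Suc i)))"
      using that relpow_fun_conv[of x x n r] by (simp add: r_def)
    then obtain f where f: "f 0 = x" "f n = x" "\<forall>i<n. R (f i) (f (Suc i))" by blast
    have "closed_walk R n (\<lambda>k. f (k mod n))"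
    proof (rule closed_walk_mod)
      show "R (f (n - 1)) (f 0)" using f n by (metis One_nat_def Suc_pred lessI odd_pos)
    qed (use f n odd_pos in auto)
    then show False using odd n by blast
  qed
  define rep where "rep x = (SOME y. (y, x) \<in> r\<^sup>*)" for x
  have rep: "(rep x, x) \<in> r\<^sup>*" for x
    unfolding rep_def by (rule someI[of _ x]) simp
  define A where "A = {x. \<exists>n. even n \<and> (rep x, x) \<in> r ^^ n}"
  have "x \<in> A \<longleftrightarrow> y \<notin> A" if xy: "R x y" for x y
  proof -
    \<comment> \<open>Related nodes have the same set of nodes reaching them, so the choice operator
      picks the same representative for both.\<close>
    have "(z, x) \<in> r\<^sup>* \<longleftrightarrow> (z, y) \<in> r\<^sup>*" for z
      using xy sym by (auto simp: r_def intro: rtrancl_into_rtrancl)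
    then have same: "rep x = rep y" by (simp add: rep_def)
    obtain m where m: "(rep x, x) \<in> r ^^ m" using rep rtrancl_power by blast
    have m': "(rep y, y) \<in> r ^^ Suc m" using m xy same by (auto simp: r_def)
    have par: "even k \<longleftrightarrow> even l" if "(rep z, z) \<in> r ^^ k" "(rep z, z) \<in> r ^^ l" for z k l
    proof -
      have "(rep z, rep z) \<in> r ^^ (k + l)"
        using that symr by (auto simp: relpow_add)
      then show ?thesis using even by fastforce
    qed
    have "x \<in> A \<longleftrightarrow> even m" unfolding A_def using m par by blast
    moreover have "y \<in> A \<longleftrightarrow> even (Suc m)" unfolding A_def using m' par by blast
    ultimately show ?thesis by simp
  qed
  then show ?thesis by blast
qed

text \<open>Two positions split the walk into parts of \<open>d\<close> and \<open>n - d\<close>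
  steps, exactly one of them odd. If the nodes coincide, the odd part is a shorter odd closed walk;
  if they are related, the even part together with the chord is one.\<close>

lemma minimal_odd_closed_walk:
  assumes sym: "\<And>x y. R x y \<Longrightarrow> R y x" and h: "closed_walk R n h" "odd n"
    and min: "\<And>m g. odd m \<Longrightarrow> m < n \<Longrightarrow> \<not> closed_walk R m g"
    and d: "2 \<le> d" "d + 2 \<le> n"
  shows "\<not> R (h a) (h (a + d)) \<and> h a \<noteq> h (a + d)"
proof -
  have per: "h (b + n) = h b" and step: "R (h b) (h (Suc b))" for b
    using h by (auto simp: closed_walk_def)
  have no: False if "odd m" "m < n" "R (h (b + (m - 1))) (h b)" for m b
  proof -
    have "closed_walk R m (\<lambda>k. h (b + k mod m))"
      by (rule closed_walk_mod[where g = "\<lambda>k. h (b + k)"]) (use that step odd_pos in auto)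
    then show False using min that by blast
  qed
  show ?thesis
  proof (cases "odd d")
    case True
    have "a + d + (n - d + 1 - 1) = a + n" using d by simp
    then have "\<not> R (h a) (h (a + d))"
      using no[of "n - d + 1" "a + d"] per[of a] True h(2) d by fastforce
    moreover have "h (a + d) = h (Suc (a + (d - 1)))" using d by (simp add: Suc_diff_Suc)
    then have "h a \<noteq> h (a + d)" using no[of d a] step[of "a + (d - 1)"] True d by fastforce
    ultimately show ?thesis by blast
  next
    case False
    have "\<not> R (h a) (h (a + d))" using no[of "d + 1" a] sym False d by fastforce
    moreover have "Suc (a + d + (n - d - 1)) = a + n" using d by simp
    then have "h a \<noteq> h (a + d)"
      using no[of "n - d" "a + d"] step[of "a + d + (n - d - 1)"] per[of a] False h(2) d by fastforce
    ultimately show ?thesis by blast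
  qed
qed

text \<open>The nodes are \<open>h 0, \<dots>, h (n - 1)\<close>, continued periodically; consecutive ones are nonadjacent.\<close>

definition antihole :: "('n \<Rightarrow> 'n \<Rightarrow> bool) \<Rightarrow> nat \<Rightarrow> (nat \<Rightarrow> 'n) \<Rightarrow> bool" where
  "antihole E n h \<longleftrightarrow> (\<forall>a. h (a + n) = h a) \<and> (\<forall>a. h a \<noteq> h (Suc a) \<and> \<not> E (h a) (h (Suc a))) \<and>
     (\<forall>a d. 2 \<le> d \<longrightarrow> d + 2 \<le> n \<longrightarrow> E (h a) (h (a + d)))"

lemma claw_freeD:
  "claw_free E \<Longrightarrow> E v a \<Longrightarrow> E v b \<Longrightarrow> E v c \<Longrightarrow> a \<noteq> b \<Longrightarrow> a \<noteq> c \<Longrightarrow> b \<noteq> c \<Longrightarrow>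
    E a b \<or> E a c \<or> E b c"
  unfolding claw_free_def by blast

text \<open>Splitting the neighbourhood of \<open>v\<close> into two cliques means 2-colouring its
  complement. If that fails, a shortest odd closed walk of the complement is chordless, and length
  three would be a claw at \<open>v\<close>.\<close>

lemma not_quasi_line_antihole:
  fixes E :: "'n::finite \<Rightarrow> 'n \<Rightarrow> bool"
  assumes G: "simple_graph E" and cf: "claw_free E" and nq: "\<not> quasi_line E"
  obtains v n h where "odd n" "5 \<le> n" "antihole E n h" "\<forall>a. E v (h a)"
proof -
  obtain v where v: "\<not> (\<exists>A B. A \<union> B = neighborhood E v \<and> A \<inter> B = {} \<and> clique E A \<and> clique E B)"
    using nq unfolding quasi_line_def by blast
  have symE: "E x y = E y x" for x y using G by (auto simp: simple_graph_def)
  define R where "R x y \<longleftrightarrow> E v x \<and> E v y \<and> x \<noteq> y \<and> \<not> E x y" for x y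
  have symR: "R x y \<Longrightarrow> R y x" for x y using symE by (auto simp: R_def)
  have "\<exists>n. odd n \<and> (\<exists>h. closed_walk R n h)"
  proof (rule ccontr)
    assume "\<not> ?thesis"
    then obtain A where A: "\<forall>x y. R x y \<longrightarrow> (x \<in> A \<longleftrightarrow> y \<notin> A)"
      using two_colouring[of R] symR by blast
    let ?N = "neighborhood E v"
    have "clique E (?N \<inter> A)" "clique E (?N - A)"
      using A by (auto simp: clique_def neighborhood_def R_def)
    then show False using v by (metis Int_Diff_Un Int_Diff_disjoint)
  qed
  then obtain n h where n: "odd n" and h: "closed_walk R n h"
    and min: "\<And>m. m < n \<Longrightarrow> \<not> (odd m \<and> (\<exists>h. closed_walk R m h))"
    using exists_least_iff[of "\<lambda>n. odd n \<and> (\<exists>h. closed_walk R n h)"] by blast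
  have per: "h (a + n) = h a" and step: "R (h a) (h (Suc a))" for a
    using h by (auto simp: closed_walk_def)
  have hv: "E v (h a)" for a using step by (simp add: R_def)
  have ind: "\<not> R (h a) (h (a + d)) \<and> h a \<noteq> h (a + d)" if "2 \<le> d" "d + 2 \<le> n" for a d
    using minimal_odd_closed_walk[OF symR h n _ that] min by blast
  have "n \<noteq> 1" using per[of 0] step[of 0] by (auto simp: R_def)
  moreover have "n \<noteq> 3"
  proof
    assume "n = 3"
    then have "h 3 = h 0" using per[of 0] by simp
    moreover have "R (h 0) (h 1)" "R (h 1) (h 2)" "R (h 2) (h 3)"
      using step[of 0] step[of 1] step[of 2] by (simp_all add: numeral_2_eq_2 numeral_3_eq_3)
    ultimately show False
      using claw_freeD[OF cf, of v "h 0" "h 1" "h 2"] hv symE by (auto simp: R_def)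
  qed
  ultimately have "5 \<le> n" using n by presburger
  moreover have "antihole E n h"
    unfolding antihole_def using per step ind hv by (auto simp: R_def)
  ultimately show thesis using that n hv by blast
qed

section \<open>Antiholes of length at least seven\<close>

lemma antihole_shift:
  assumes h: "antihole E n h"
  shows "antihole E n (\<lambda>k. h (k + s))"
  unfolding antihole_def
proof (intro conjI allI impI)
  fix a d :: nat
  have "h (a + s + n) = h (a + s)" "h (a + s) \<noteq> h (Suc (a + s))" "\<not> E (h (a + s)) (h (Suc (a + s)))"
    using h by (auto simp: antihole_def)
  then show "h (a + n + s) = h (a + s)" "h (a + s) \<noteq> h (Suc a + s)" "\<not> E (h (a + s)) (h (Suc a + s))"
    by (simp_all add: add_ac)
  assume "2 \<le> d" "d + 2 \<le> n"
  then have "E (h (a + s)) (h (a + s + d))" using h by (simp add: antihole_def)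
  then show "E (h (a + s)) (h (a + d + s))" by (simp add: add_ac)
qed

lemma antihole_mod:
  assumes h: "antihole E n h"
  shows "h (a mod n) = h a"
proof -
  have "h (a mod n + n * k) = h (a mod n)" for k
  proof (induction k)
    case (Suc k)
    have "h (a mod n + n * k + n) = h (a mod n + n * k)" using h by (simp add: antihole_def)
    then show ?case using Suc by (simp add: add_ac)
  qed simp
  from this[of "a div n"] show ?thesis by simp
qed

lemma antihole_adj:
  assumes "antihole E n h" "b + 2 \<le> c" "c + 2 \<le> b + n"
  shows "E (h b) (h c)"
proof -
  have "E (h b) (h (b + (c - b)))" using assms unfolding antihole_def by (metis le_add_diff_inverse
    add_le_imp_le_diff add.commute le_diff_conv add_leD1 diff_add_assoc nat_add_left_cancel_le)
  then show ?thesis using assms by simp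
qed

lemma antihole_rotate:
  assumes h: "antihole E n h" and n: "0 < n"
  obtains j where "j < n" "h b = h (j + a)"
proof
  define k where "k = b mod n + n - a mod n"
  have "a mod n < n" using n by simp
  then have "(k + a) mod n = (b mod n + n - a mod n + a mod n) mod n"
    unfolding k_def by (metis mod_add_right_eq)
  also have "\<dots> = b mod n" using \<open>a mod n < n\<close> by simp
  finally have "(k mod n + a) mod n = b mod n" by (simp add: mod_add_left_eq)
  then show "h b = h (k mod n + a)" using antihole_mod[OF h] by metis
  show "k mod n < n" using n by simp
qed

text \<open>Two consecutive nodes missed by \<open>x\<close> are nonadjacent, so a common neighbour
  of them that sees \<open>x\<close> would be the centre of a claw. Non-adjacency to
  \<open>x\<close> therefore spreads over the whole antihole.\<close>

lemma antihole_attached: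
  fixes E :: "'n::finite \<Rightarrow> 'n \<Rightarrow> bool"
  assumes G: "simple_graph E" and cf: "claw_free E" and h: "antihole E n h" and n: "7 \<le> n"
    and x: "x \<notin> range h" "E x (h b)"
  shows "E x (h a) \<or> E x (h (Suc a))"
proof (rule ccontr)
  assume neg: "\<not> ?thesis"
  have symE: "E u v = E v u" for u v using G by (auto simp: simple_graph_def)
  define g where "g k = h (k + a)" for k
  have g: "antihole E n g" unfolding g_def by (rule antihole_shift[OF h])
  have "0 < n" using n by simp
  then obtain j where j: "j < n" "h b = g j"
    using antihole_rotate[OF h] unfolding g_def by metis
  have xg: "x \<noteq> g k" for k using x by (auto simp: g_def)
  have claw: "\<not> E x (g k)" if "E (g k) (g c)" "E (g k) (g (Suc c))" "\<not> E x (g c)" "\<not> E x (g (Suc c))" for k c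
    using that claw_freeD[OF cf, of "g k" x "g c" "g (Suc c)"] xg g symE unfolding antihole_def by blast
  have g01: "\<not> E x (g 0)" "\<not> E x (g 1)" using neg by (simp_all add: g_def)
  have mid: "\<not> E x (g k)" if "3 \<le> k" "k + 2 \<le> n" for k
    using claw[of k 0] antihole_adj[OF g, of 0 k] antihole_adj[OF g, of 1 k] that g01 symE by auto
  \<comment> \<open>\<open>g 2\<close> and \<open>g (n - 1)\<close> do not see both
    \<open>g 0\<close> and \<open>g 1\<close>. They need a second missed pair,
    \<open>g 4, g 5\<close> and \<open>g 3, g 4\<close>; this is where length seven enters.\<close>
  have "\<not> E x (g 2)"
    using claw[of 2 4] antihole_adj[OF g, of 2 4] antihole_adj[OF g, of 2 5] mid[of 4] mid[of 5] n by simp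
  moreover have "\<not> E x (g (n - 1))"
    using claw[of "n - 1" 3] antihole_adj[OF g, of 3 "n - 1"] antihole_adj[OF g, of 4 "n - 1"]
      mid[of 3] mid[of 4] n symE by simp
  moreover have "j = 0 \<or> j = 1 \<or> j = 2 \<or> (3 \<le> j \<and> j + 2 \<le> n) \<or> j = n - 1" using j(1) by linarith
  ultimately have "\<not> E x (g j)" using g01 mid by blast
  then show False using x j by simp
qed

text \<open>A node attached to the antihole sees two consecutive, hence nonadjacent, nodes of it,
  and a further unattached neighbour would complete a claw. So the unattached nodes are closed under
  adjacency, and connectedness leaves none.\<close>

lemma antihole_dominates:
  fixes E :: "'n::finite \<Rightarrow> 'n \<Rightarrow> bool"
  assumes G: "simple_graph E" and cf: "claw_free E" and h: "antihole E n h" and n: "7 \<le> n" "odd n"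
    and conn: "\<forall>Z. Z \<noteq> {} \<longrightarrow> (\<forall>u\<in>Z. \<forall>v. E u v \<longrightarrow> v \<in> Z) \<longrightarrow> Z = UNIV"
    and x: "x \<noteq> h a" "x \<noteq> h (Suc a)"
  shows "E x (h a) \<or> E x (h (Suc a))"
proof (cases "x \<in> range h")
  case True
  then obtain b where "x = h b" by blast
  moreover have "0 < n" using n by simp
  ultimately obtain j where j: "j < n" "x = h (j + a)" using antihole_rotate[OF h] by metis
  have g: "antihole E n (\<lambda>k. h (k + a))" by (rule antihole_shift[OF h])
  have symE: "E u v = E v u" for u v using G by (auto simp: simple_graph_def)
  have "j \<noteq> 0" "j \<noteq> 1" using j x by (metis add_0, metis plus_1_eq_Suc)
  then consider "2 \<le> j" "j + 2 \<le> n" | "j = n - 1" using j(1) by linarith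
  then show ?thesis
  proof cases
    case 1
    then show ?thesis using antihole_adj[OF g, of 0 j] j symE by simp
  next
    case 2
    then show ?thesis using antihole_adj[OF g, of 1 j] j n symE by simp
  qed
next
  case False
  have symE: "E u v = E v u" for u v using G by (auto simp: simple_graph_def)
  define Z where "Z = {z. z \<notin> range h \<and> (\<forall>b. \<not> E z (h b))}"
  have Z: "v \<in> Z" if uv: "u \<in> Z" "E u v" for u v
  proof (rule ccontr)
    assume "v \<notin> Z"
    moreover have vh: "v \<notin> range h" using uv by (auto simp: Z_def)
    ultimately obtain b where b: "E v (h b)" by (auto simp: Z_def)
    have one: "E v (h c) \<or> E v (h (Suc c))" for c
      by (rule antihole_attached[OF G cf h n(1) vh b])
    \<comment> \<open>Of any two consecutive nodes at least one is seen; seeing exactly one each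
      time would alternate around a cycle of odd length.\<close>
    have "\<exists>c. E v (h c) \<and> E v (h (Suc c))"
    proof (rule ccontr)
      assume "\<not> ?thesis"
      then have alt: "E v (h (Suc c)) \<longleftrightarrow> \<not> E v (h c)" for c using one by blast
      have "E v (h c) \<longleftrightarrow> (E v (h 0) \<longleftrightarrow> even c)" for c by (induction c) (auto simp: alt)
      from this[of n] show False using n h by (metis add_0 antihole_def)
    qed
    then obtain c where c: "E v (h c)" "E v (h (Suc c))" by blast
    have "u \<noteq> h k" "\<not> E u (h k)" for k using uv(1) by (auto simp: Z_def)
    then show False
      using claw_freeD[OF cf, of v u "h c" "h (Suc c)"] c uv(2) symE h unfolding antihole_def by blast
  qed
  have "Z = {}"
  proof (rule ccontr)
    assume "Z \<noteq> {}"
    then have "h 0 \<in> Z" using conn Z by blast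
    then show False by (simp add: Z_def)
  qed
  then obtain b where "E x (h b)" using False unfolding Z_def by blast
  then show ?thesis using antihole_attached[OF G cf h n(1) False] by blast
qed

text \<open>Double counting: no node of the antihole has three neighbours in \<open>S\<close>, but every node of \<open>S\<close> outside
  the antihole is adjacent to more than half of it.\<close>

lemma no_large_antihole:
  fixes E :: "'n::finite \<Rightarrow> 'n \<Rightarrow> bool"
  assumes G: "simple_graph E" and cf: "claw_free E" and h: "antihole E n h" and n: "7 \<le> n" "odd n"
    and conn: "\<forall>Z. Z \<noteq> {} \<longrightarrow> (\<forall>u\<in>Z. \<forall>v. E u v \<longrightarrow> v \<in> Z) \<longrightarrow> Z = UNIV"
    and S: "stable_set E S" "card S = 4"
  shows False
proof -
  have symE: "E u v = E v u" for u v using G by (auto simp: simple_graph_def)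
  note dom = antihole_dominates[OF G cf h n conn]
  have two: "card {s \<in> T. E s y} \<le> 2" if "T \<subseteq> S" for T y
  proof (rule card_le_2_of_no_triple)
    fix p q r assume "p \<in> {s \<in> T. E s y}" "q \<in> {s \<in> T. E s y}" "r \<in> {s \<in> T. E s y}"
      and "p \<noteq> q" "p \<noteq> r" "q \<noteq> r"
    then show False
      using that S(1) claw_freeD[OF cf, of y p q r] symE unfolding stable_set_def by blast
  qed
  show False
  proof (cases "S \<inter> range h = {}")
    case False
    then obtain a where a: "h a \<in> S" by blast
    have nadj: "\<not> E t (h a)" if "t \<in> S" for t using that a S(1) by (simp add: stable_set_def)
    \<comment> \<open>If \<open>S\<close> contains \<open>h a\<close>, its other members miss
      \<open>h a\<close> and must all see \<open>h (Suc a)\<close>, unless they equal it. Three of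
      them are too many.\<close>
    have far: "E t (h (Suc a))" if "t \<in> S - {h a}" "t \<noteq> h (Suc a)" for t
      using dom[of t a] nadj that by blast
    show False
    proof (cases "h (Suc a) \<in> S")
      case True
      have "S \<subseteq> {h a, h (Suc a)}"
        using far True S(1) unfolding stable_set_def by blast
      then have "card S \<le> card {h a, h (Suc a)}" by (intro card_mono) auto
      also have "\<dots> \<le> 2" by (simp add: card_insert_if)
      finally show False using S(2) by simp
    next
      case False
      have "S - {h a} = {s \<in> S - {h a}. E s (h (Suc a))}" using far False by blast
      then have "card (S - {h a}) \<le> 2" using two[of "S - {h a}" "h (Suc a)"] by simp
      then show False using S(2) a by simp
    qed
  next
    case True
    define e where "e s a = (of_bool (E s (h a)) :: nat)" for s a
    \<comment> \<open>Each of the \<open>n\<close> consecutive pairs is hit, and odd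
      \<open>n\<close> rounds \<open>n / 2\<close> up. Four nodes then give at least
      \<open>2 * (n + 1)\<close> adjacencies, against at most \<open>2 * n\<close>.\<close>
    have deg: "n + 1 \<le> 2 * (\<Sum>a<n. e s a)" if s: "s \<in> S" for s
    proof -
      have "1 \<le> e s a + e s (Suc a)" for a
        using dom[of s a] s True unfolding e_def by force
      then have "(\<Sum>a<n. 1) \<le> (\<Sum>a<n. e s a + e s (Suc a))" by (intro sum_mono) auto
      also have "\<dots> = (\<Sum>a<n. e s a) + (\<Sum>a<n. e s (Suc a))" by (rule sum.distrib)
      also have "(\<Sum>a<n. e s (Suc a)) = (\<Sum>a<n. e s a)"
      proof -
        have "e s n = e s 0" using h by (metis add_0 antihole_def e_def)
        moreover have "(\<Sum>a<Suc n. e s a) = e s 0 + (\<Sum>a<n. e s (Suc a))" by (rule sum.lessThan_Suc_shift)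
        ultimately show ?thesis by simp
      qed
      finally have "n \<le> 2 * (\<Sum>a<n. e s a)" by simp
      then show ?thesis using n(2) by presburger
    qed
    have "4 * (n + 1) = (\<Sum>s\<in>S. n + 1)" using S(2) by simp
    also have "\<dots> \<le> (\<Sum>s\<in>S. 2 * (\<Sum>a<n. e s a))" using deg by (intro sum_mono) auto
    also have "\<dots> = 2 * (\<Sum>a<n. \<Sum>s\<in>S. e s a)" by (subst sum.swap) (simp add: sum_distrib_left)
    also have "(\<Sum>a<n. \<Sum>s\<in>S. e s a) \<le> (\<Sum>a<n. 2)"
    proof (rule sum_mono)
      fix a
      have "(\<Sum>s\<in>S. e s a) = card {s \<in> S. E s (h a)}" by (simp add: e_def sum.If_cases of_bool_def Int_def)
      then show "(\<Sum>s\<in>S. e s a) \<le> 2" using two by simp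
    qed
    finally show False by simp
  qed
qed

section \<open>5-wheels\<close>

text \<open>The odd hole runs through \<open>a, a', a''\<close>, back along \<open>f\<close> from
  \<open>f (2 * q)\<close> to \<open>f 0\<close>, and through \<open>b\<close>; its length is
  \<open>2 * q + 5\<close>, and \<open>x\<close> sees only \<open>a, a', a''\<close> on it.\<close>

lemma LT_stretch_imperfect:
  fixes E :: "'n::finite \<Rightarrow> 'n \<Rightarrow> bool"
  assumes G: "simple_graph E"
    and adj: "E a a'" "E a' a''" "E x a" "E x a'" "E x a''" "E b a"
    and non: "\<not> E a a''" "\<not> E b a'" "\<not> E b a''" "\<not> E b x"
    and inj: "inj_on f {..2 * q}"
    and ff: "\<And>i j. i \<le> 2 * q \<Longrightarrow> j \<le> 2 * q \<Longrightarrow> E (f i) (f j) \<longleftrightarrow> i = Suc j \<or> j = Suc i"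
    and fb: "\<And>i. i \<le> 2 * q \<Longrightarrow> E b (f i) \<longleftrightarrow> i = 0"
    and fa: "\<And>i. i \<le> 2 * q \<Longrightarrow> E a'' (f i) \<longleftrightarrow> i = 2 * q"
    and fo: "\<And>i. i \<le> 2 * q \<Longrightarrow> \<not> E a (f i) \<and> \<not> E a' (f i) \<and> \<not> E x (f i)"
  shows "\<not> LS_plus_perfect E"
proof -
  have symE: "E u v = E v u" and irr: "\<not> E u u" for u v using G by (auto simp: simple_graph_def)
  have d: "distinct [a, a', a'', b, x]" using adj non symE irr by auto
  have df: "f i \<notin> {a, a', a'', b, x}" if "i \<le> 2 * q" for i
    using fo[OF that] adj symE by auto
  define g where "g k = (case k of N0 \<Rightarrow> a | N1 \<Rightarrow> a' | N2 \<Rightarrow> a'' | N3 \<Rightarrow> b | N4 \<Rightarrow> x | NP \<Rightarrow> f 0)" for k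
  note [simp] = symE[of a' a] symE[of a'' a'] symE[of a x] symE[of a' x] symE[of a'' x] symE[of a b]
    symE[of a'' a] symE[of a' b] symE[of a'' b] symE[of x b]
  show ?thesis
  proof (rule LS_plus_imperfect_stretch[OF edge_matrix_LT card_stable_set_LT _ _ simple_graph_LT inj,
        where P = NP and g = g and L = "\<lambda>k. k = N3" and R = "\<lambda>k. k = N2"])
    show "real 2 < (\<Sum>k\<in>UNIV. LT_matrix (Some k) None)" using rank_violation by simp
    show "E v u" if "E u v" for u v using that symE by blast
    show "inj_on g (- {NP})"
      using d by (intro inj_onI) (auto simp: g_def split: node.splits)
    show "f i \<noteq> g k" if "i \<le> 2 * q" "k \<noteq> NP" for i k
      using df[OF that(1)] that(2) by (cases k) (auto simp: g_def)
    show "E (g k) (g l) \<longleftrightarrow> LT_graph k l" if "k \<noteq> NP" "l \<noteq> NP" for k l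
      using that adj non irr by (cases k; cases l) (simp_all add: g_def LT_graph_def doubleton_eq_iff)
    show "E (g k) (f i) \<longleftrightarrow> (i = 0 \<and> k = N3) \<or> (i = 2 * q \<and> k = N2)" if "k \<noteq> NP" "i \<le> 2 * q" for k i
      using that(1) fb[OF that(2)] fa[OF that(2)] fo[OF that(2)] by (cases k) (auto simp: g_def)
    show "LT_graph k NP \<longleftrightarrow> k = N3 \<or> k = N2" if "k \<noteq> NP" for k
      using that by (cases k) (simp_all add: LT_graph_def doubleton_eq_iff)
  qed (use ff in auto)
qed

definition hole5 :: "('n \<Rightarrow> 'n \<Rightarrow> bool) \<Rightarrow> 'n \<Rightarrow> 'n \<Rightarrow> 'n \<Rightarrow> 'n \<Rightarrow> 'n \<Rightarrow> bool" where
  "hole5 E c0 c1 c2 c3 c4 \<longleftrightarrow> E c0 c1 \<and> E c1 c2 \<and> E c2 c3 \<and> E c3 c4 \<and> E c4 c0 \<and>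
     \<not> E c0 c2 \<and> \<not> E c1 c3 \<and> \<not> E c2 c4 \<and> \<not> E c3 c0 \<and> \<not> E c4 c1"

lemma EMN_stretch_imperfect:
  fixes E :: "'n::finite \<Rightarrow> 'n \<Rightarrow> bool"
  assumes G: "simple_graph E" and hole: "hole5 E c0 c1 c2 c3 c4"
    and inj: "inj_on f {..2 * q}"
    and ff: "\<And>i j. i \<le> 2 * q \<Longrightarrow> j \<le> 2 * q \<Longrightarrow> E (f i) (f j) \<longleftrightarrow> i = Suc j \<or> j = Suc i"
    and f0: "\<And>i. i \<le> 2 * q \<Longrightarrow> (E c0 (f i) \<longleftrightarrow> i = 0) \<and> (E c1 (f i) \<longleftrightarrow> i = 0)"
    and f1: "\<And>i. i \<le> 2 * q \<Longrightarrow> (E c2 (f i) \<longleftrightarrow> i = 2 * q) \<and> (E c3 (f i) \<longleftrightarrow> i = 2 * q)"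
    and fo: "\<And>i. i \<le> 2 * q \<Longrightarrow> \<not> E c4 (f i)"
  shows "\<not> LS_plus_perfect E"
proof -
  have symE: "E u v = E v u" and irr: "\<not> E u u" for u v using G by (auto simp: simple_graph_def)
  have d: "distinct [c0, c1, c2, c3, c4]" using hole symE irr unfolding hole5_def by auto
  have df: "f i \<notin> {c0, c1, c2, c3, c4}" if "i \<le> 2 * q" for i
    using fo[OF that] f0[OF that] f1[OF that] hole symE irr unfolding hole5_def by (auto 0 3)
  define g where "g k = (case k of N0 \<Rightarrow> c0 | N1 \<Rightarrow> c1 | N2 \<Rightarrow> c2 | N3 \<Rightarrow> c3 | N4 \<Rightarrow> c4 | NP \<Rightarrow> f 0)" for k
  note [simp] = symE[of c1 c0] symE[of c2 c1] symE[of c3 c2] symE[of c4 c3] symE[of c0 c4]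
    symE[of c2 c0] symE[of c3 c1] symE[of c4 c2] symE[of c0 c3] symE[of c1 c4]
  show ?thesis
  proof (rule LS_plus_imperfect_stretch[OF edge_matrix_EMN card_stable_set_EMN _ _ simple_graph_EMN inj,
        where P = NP and g = g and L = "\<lambda>k. k = N0 \<or> k = N1" and R = "\<lambda>k. k = N2 \<or> k = N3"])
    show "real 2 < (\<Sum>k\<in>UNIV. EMN_matrix (Some k) None)" using rank_violation by simp
    show "E v u" if "E u v" for u v using that symE by blast
    show "inj_on g (- {NP})"
      using d by (intro inj_onI) (auto simp: g_def split: node.splits)
    show "f i \<noteq> g k" if "i \<le> 2 * q" "k \<noteq> NP" for i k
      using df[OF that(1)] that(2) by (cases k) (auto simp: g_def)
    show "E (g k) (g l) \<longleftrightarrow> EMN_graph k l" if "k \<noteq> NP" "l \<noteq> NP" for k l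
      using that hole irr unfolding hole5_def
      by (cases k; cases l) (simp_all add: g_def EMN_graph_def doubleton_eq_iff)
    show "E (g k) (f i) \<longleftrightarrow> (i = 0 \<and> (k = N0 \<or> k = N1)) \<or> (i = 2 * q \<and> (k = N2 \<or> k = N3))"
      if "k \<noteq> NP" "i \<le> 2 * q" for k i
      using that(1) f0[OF that(2)] f1[OF that(2)] fo[OF that(2)] by (cases k) (auto simp: g_def)
    show "EMN_graph k NP \<longleftrightarrow> (k = N0 \<or> k = N1) \<or> (k = N2 \<or> k = N3)" if "k \<noteq> NP" for k
      using that by (cases k) (simp_all add: EMN_graph_def doubleton_eq_iff)
  qed (use ff in auto)
qed

text \<open>In a walk with the fewest steps a chord would give a shortcut. A repeated node either
  lets the walk stop earlier in \<open>B\<close> or yields a chord to the successor of its second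
  occurrence.\<close>

lemma shortest_connecting_path:
  fixes E :: "'a \<Rightarrow> 'a \<Rightarrow> bool"
  assumes sym: "\<And>u v. E u v \<longleftrightarrow> E v u" and irr: "\<And>v. \<not> E v v" and AB: "A \<inter> B = {}"
    and walk: "f 0 \<in> A" "f m \<in> B" "\<forall>i. 0 < i \<and> i < m \<longrightarrow> f i \<in> Z" "\<forall>i<m. E (f i) (f (Suc i))"
  obtains p n where "p 0 \<in> A" "p n \<in> B" "\<And>i. 0 < i \<Longrightarrow> i < n \<Longrightarrow> p i \<in> Z" "0 < n" "inj_on p {..n}"
    "\<And>i j. i \<le> n \<Longrightarrow> j \<le> n \<Longrightarrow> E (p i) (p j) \<longleftrightarrow> i = Suc j \<or> j = Suc i"
proof -
  define walk where "walk p n \<longleftrightarrow> p 0 \<in> A \<and> p n \<in> B \<and> (\<forall>i. 0 < i \<and> i < n \<longrightarrow> p i \<in> Z) \<and>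
    (\<forall>i<n. E (p i) (p (Suc i)))" for p :: "nat \<Rightarrow> 'a" and n
  have "\<exists>n p. walk p n" using walk unfolding walk_def by blast
  then obtain n p where p: "walk p n" and min: "\<And>k. k < n \<Longrightarrow> \<not> (\<exists>p. walk p k)"
    using exists_least_iff[of "\<lambda>n. \<exists>p. walk p n"] by blast
  have pA: "p 0 \<in> A" and pB: "p n \<in> B" and pZ: "\<And>i. 0 < i \<Longrightarrow> i < n \<Longrightarrow> p i \<in> Z"
    and pE: "\<And>i. i < n \<Longrightarrow> E (p i) (p (Suc i))"
    using p by (auto simp: walk_def)
  have "0 < n" using pA pB AB by (cases n) auto
  have short: False if ij: "i + s < n" "0 < s" "E (p i) (p (Suc i + s))" for i s
  proof -
    have "walk (\<lambda>k. if k \<le> i then p k else p (k + s)) (n - s)"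
      unfolding walk_def
    proof (intro conjI allI impI)
      show "(if 0 \<le> i then p 0 else p (0 + s)) \<in> A" using pA by simp
      show "(if n - s \<le> i then p (n - s) else p (n - s + s)) \<in> B" using pB ij by auto
      show "(if k \<le> i then p k else p (k + s)) \<in> Z" if "0 < k \<and> k < n - s" for k
        using that ij by (auto intro: pZ)
      show "E (if k \<le> i then p k else p (k + s)) (if Suc k \<le> i then p (Suc k) else p (Suc k + s))"
        if "k < n - s" for k
      proof -
        consider "k < i" | "k = i" | "i < k" by linarith
        then show ?thesis
          by cases (use that ij pE[of k] pE[of "k + s"] in auto)
      qed
    qed
    then show False using min[of "n - s"] ij by auto
  qed
  have noadj: "\<not> E (p i) (p j)" if "Suc i < j" "j \<le> n" for i j
  proof
    assume "E (p i) (p j)"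
    moreover have "i + (j - Suc i) < n" "0 < j - Suc i" "Suc i + (j - Suc i) = j" using that by linarith+
    ultimately show False using short[of i "j - Suc i"] by simp
  qed
  have neq: "p i \<noteq> p j" if "i < j" "j \<le> n" for i j
  proof
    assume eq: "p i = p j"
    show False
    proof (cases "j = n")
      case True
      then have "walk p i" using p eq that unfolding walk_def by auto
      moreover have "i < n" using that by simp
      ultimately show False using min by blast
    next
      case False
      then have "E (p i) (p (Suc j))" using pE[of j] eq that by simp
      then show False using noadj[of i "Suc j"] that False by simp
    qed
  qed
  show thesis
  proof (rule that[OF pA pB pZ \<open>0 < n\<close>])
    show "inj_on p {..n}" using neq by (intro inj_onI) (metis atMost_iff linorder_neqE_nat)
    show "E (p i) (p j) \<longleftrightarrow> i = Suc j \<or> j = Suc i" if "i \<le> n" "j \<le> n" for i j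
    proof -
      consider "i = j" | "j = Suc i" | "i = Suc j" | "Suc i < j" | "Suc j < i" by linarith
      then show ?thesis
        by cases (use that irr sym pE[of i] pE[of j] noadj[of i j] noadj[of j i] in auto)
    qed
  qed
qed


text \<open>The path closes two holes through the rim, along \<open>c1 c2\<close> and along \<open>c0 c4 c3\<close>, of different parity.
  For even \<open>m\<close> the path is a stretched node adjacent to four rim nodes. For odd \<open>m\<close> the second
  hole is odd, and the hub sees the three consecutive nodes \<open>c0 c4 c3\<close> of it.\<close>

lemma path_imperfect:
  fixes E :: "'n::finite \<Rightarrow> 'n \<Rightarrow> bool"
  assumes G: "simple_graph E" and hole: "hole5 E c0 c1 c2 c3 c4"
    and hub: "E w c0" "E w c1" "E w c2" "E w c3" "E w c4"
    and m: "0 < m" and inj: "inj_on f {..m}"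
    and ff: "\<And>i j. i \<le> m \<Longrightarrow> j \<le> m \<Longrightarrow> E (f i) (f j) \<longleftrightarrow> i = Suc j \<or> j = Suc i"
    and f0: "\<And>i. i \<le> m \<Longrightarrow> (E c0 (f i) \<longleftrightarrow> i = 0) \<and> (E c1 (f i) \<longleftrightarrow> i = 0)"
    and f1: "\<And>i. i \<le> m \<Longrightarrow> (E c2 (f i) \<longleftrightarrow> i = m) \<and> (E c3 (f i) \<longleftrightarrow> i = m)"
    and fo: "\<And>i. i \<le> m \<Longrightarrow> \<not> E c4 (f i) \<and> \<not> E w (f i)"
  shows "\<not> LS_plus_perfect E"
proof (cases "even m")
  case True
  then obtain q where q: "m = 2 * q" by blast
  show ?thesis
    by (rule EMN_stretch_imperfect[OF G hole, of f q]) (use inj ff f0 f1 fo q in auto)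
next
  case False
  then obtain q where q: "m = Suc (2 * q)" by (metis oddE Suc_eq_plus1)
  have symE: "E u v = E v u" for u v using G by (auto simp: simple_graph_def)
  show ?thesis
  \<comment> \<open>With \<open>m = 2 * q + 1\<close>, the node \<open>f 0\<close> plays the role of
    \<open>b\<close>, so that \<open>f 1, ..., f m\<close> is a path with the required odd number of
    nodes.\<close>
  proof (rule LT_stretch_imperfect[OF G, where a = c0 and a' = c4 and a'' = c3 and x = w
        and b = "f 0" and q = q and f = "\<lambda>i. f (Suc i)"])
    show "inj_on (\<lambda>i. f (Suc i)) {..2 * q}"
      using inj q by (auto simp: inj_on_def)
    show "E (f (Suc i)) (f (Suc j)) \<longleftrightarrow> i = Suc j \<or> j = Suc i" if "i \<le> 2 * q" "j \<le> 2 * q" for i j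
      using ff[of "Suc i" "Suc j"] that q by simp
    show "E (f 0) (f (Suc i)) \<longleftrightarrow> i = 0" if "i \<le> 2 * q" for i
      using ff[of 0 "Suc i"] that q by simp
    show "E c3 (f (Suc i)) \<longleftrightarrow> i = 2 * q" if "i \<le> 2 * q" for i
      using f1[of "Suc i"] that q by simp
    show "\<not> E c0 (f (Suc i)) \<and> \<not> E c4 (f (Suc i)) \<and> \<not> E w (f (Suc i))" if "i \<le> 2 * q" for i
      using f0[of "Suc i"] fo[of "Suc i"] that q by simp
  qed (use hole[unfolded hole5_def] hub f0[of 0] f1[of 0] fo[of 0] m symE in auto)
qed

section \<open>Nodes classified by what they see of the rim\<close>

definition wheel5 :: "('n \<Rightarrow> 'n \<Rightarrow> bool) \<Rightarrow> 'n \<Rightarrow> 'n \<Rightarrow> 'n \<Rightarrow> 'n \<Rightarrow> 'n \<Rightarrow> 'n \<Rightarrow> bool" where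
  "wheel5 E w c0 c1 c2 c3 c4 \<longleftrightarrow> hole5 E c0 c1 c2 c3 c4 \<and>
     E w c0 \<and> E w c1 \<and> E w c2 \<and> E w c3 \<and> E w c4"

lemma wheel5_rotate: "wheel5 E w c0 c1 c2 c3 c4 \<Longrightarrow> wheel5 E w c1 c2 c3 c4 c0"
  unfolding wheel5_def hole5_def by blast

definition edge_type :: "('n \<Rightarrow> 'n \<Rightarrow> bool) \<Rightarrow> 'n \<Rightarrow> 'n \<Rightarrow> 'n \<Rightarrow> 'n \<Rightarrow> 'n \<Rightarrow> 'n set" where
  "edge_type E c0 c1 c2 c3 c4 = {x. E x c0 \<and> E x c1 \<and> \<not> E x c2 \<and> \<not> E x c3 \<and> \<not> E x c4}"

definition hubs :: "('n \<Rightarrow> 'n \<Rightarrow> bool) \<Rightarrow> 'n \<Rightarrow> 'n \<Rightarrow> 'n \<Rightarrow> 'n \<Rightarrow> 'n \<Rightarrow> 'n set" where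
  "hubs E c0 c1 c2 c3 c4 = {x. E x c0 \<and> E x c1 \<and> E x c2 \<and> E x c3 \<and> E x c4}"

definition remote :: "('n \<Rightarrow> 'n \<Rightarrow> bool) \<Rightarrow> 'n \<Rightarrow> 'n \<Rightarrow> 'n \<Rightarrow> 'n \<Rightarrow> 'n \<Rightarrow> 'n set" where
  "remote E c0 c1 c2 c3 c4 = {x. \<not> E x c0 \<and> \<not> E x c1 \<and> \<not> E x c2 \<and> \<not> E x c3 \<and> \<not> E x c4}"

lemma perfect_three_four:
  fixes E :: "'n::finite \<Rightarrow> 'n \<Rightarrow> bool"
  assumes G: "simple_graph E" and perf: "LS_plus_perfect E" and hole: "hole5 E c0 c1 c2 c3 c4"
    and x: "E x c0" "E x c1" "E x c2" "\<not> E x c4"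
  shows False
proof (cases "E x c3")
  case True
  have symE: "E u v = E v u" and irr: "\<not> E u u" for u v using G by (auto simp: simple_graph_def)
  have "\<not> LS_plus_perfect E"
    by (rule EMN_stretch_imperfect[OF G hole, of "\<lambda>_. x" 0]) (use x True symE irr in auto)
  then show False using perf by blast
next
  case False
  have symE: "E u v = E v u" and irr: "\<not> E u u" for u v using G by (auto simp: simple_graph_def)
  have "\<not> LS_plus_perfect E"
  proof (rule LT_stretch_imperfect[OF G, where a = c0 and a' = c1 and a'' = c2 and x = x
        and b = c4 and q = 0 and f = "\<lambda>_. c3"])
  qed (use x False hole[unfolded hole5_def] symE irr in auto)
  then show False using perf by blast
qed

text \<open>Claw-freeness at a rim node forbids an isolated rim neighbour, so the nodes seen come in
  runs of at least two, and a rim of five has space for one run only. Perfection excludes runs of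
  three and four.\<close>

lemma wheel_types:
  fixes E :: "'n::finite \<Rightarrow> 'n \<Rightarrow> bool"
  assumes G: "simple_graph E" and cf: "claw_free E" and perf: "LS_plus_perfect E"
    and hole: "hole5 E c0 c1 c2 c3 c4" and x: "x \<notin> {c0, c1, c2, c3, c4}"
  shows "x \<in> hubs E c0 c1 c2 c3 c4 \<or> x \<in> remote E c0 c1 c2 c3 c4 \<or>
    x \<in> edge_type E c0 c1 c2 c3 c4 \<or> x \<in> edge_type E c1 c2 c3 c4 c0 \<or>
    x \<in> edge_type E c2 c3 c4 c0 c1 \<or> x \<in> edge_type E c3 c4 c0 c1 c2 \<or>
    x \<in> edge_type E c4 c0 c1 c2 c3"
proof -
  have symE: "E u v = E v u" for u v using G by (auto simp: simple_graph_def)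
  have hole1: "hole5 E c1 c2 c3 c4 c0" and hole2: "hole5 E c2 c3 c4 c0 c1"
    and hole3: "hole5 E c3 c4 c0 c1 c2" and hole4: "hole5 E c4 c0 c1 c2 c3"
    using hole by (auto simp: hole5_def)
  have claw: "E x b \<or> E x e" if h: "hole5 E a b c d e" "E x a" "x \<notin> {a, b, c, d, e}" for a b c d e
    using claw_freeD[OF cf, of a x b e] that symE unfolding hole5_def by blast
  note claws = claw[OF hole] claw[OF hole1] claw[OF hole2] claw[OF hole3] claw[OF hole4]
  note runs = perfect_three_four[OF G perf hole, of x] perfect_three_four[OF G perf hole1, of x]
    perfect_three_four[OF G perf hole2, of x] perfect_three_four[OF G perf hole3, of x]
    perfect_three_four[OF G perf hole4, of x]
  show ?thesis
    using claws runs x unfolding hubs_def remote_def edge_type_def mem_Collect_eq insert_iff empty_iff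
    by argo
qed

lemma hub_not_adjacent:
  fixes E :: "'n::finite \<Rightarrow> 'n \<Rightarrow> bool"
  assumes G: "simple_graph E" and cf: "claw_free E" and W: "wheel5 E w c0 c1 c2 c3 c4"
    and p: "\<not> E p c2" "\<not> E p c4" "p \<noteq> c2" "p \<noteq> c4"
  shows "\<not> E w p"
proof
  assume "E w p"
  moreover have "c2 \<noteq> c4" using G W unfolding wheel5_def hole5_def simple_graph_def by blast
  ultimately show False
    using claw_freeD[OF cf, of w p c2 c4] p W unfolding wheel5_def hole5_def by blast
qed

lemma cliqueD: "clique E K \<Longrightarrow> u \<in> K \<Longrightarrow> v \<in> K \<Longrightarrow> u \<noteq> v \<Longrightarrow> E u v"
  by (simp add: clique_def)

text \<open>Nonadjacent nodes of one type form a claw with the rim node just before their edge. For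
  edges meeting in \<open>c1\<close> the third leaf is the hub, which sees neither node.\<close>

lemma edge_type_clique:
  fixes E :: "'n::finite \<Rightarrow> 'n \<Rightarrow> bool"
  assumes G: "simple_graph E" and cf: "claw_free E" and W: "wheel5 E w c0 c1 c2 c3 c4"
  shows "clique E (insert c1 (edge_type E c0 c1 c2 c3 c4 \<union> edge_type E c1 c2 c3 c4 c0))"
proof -
  have symE: "E u v = E v u" and irr: "\<not> E u u" for u v using G by (auto simp: simple_graph_def)
  have W1: "wheel5 E w c1 c2 c3 c4 c0" by (rule wheel5_rotate[OF W])
  have same: "E p q" if "wheel5 E w a b c d e" "p \<in> edge_type E a b c d e" "q \<in> edge_type E a b c d e" "p \<noteq> q"
    for p q a b c d e
  proof -
    have "e \<noteq> p" "e \<noteq> q" using that irr symE unfolding edge_type_def wheel5_def hole5_def by blast+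
    then show ?thesis
      using claw_freeD[OF cf, of a e p q] that symE unfolding edge_type_def wheel5_def hole5_def by blast
  qed
  have cross: "E p q" if p: "p \<in> edge_type E c0 c1 c2 c3 c4" and q: "q \<in> edge_type E c1 c2 c3 c4 c0" for p q
  proof -
    have hp: "p \<notin> {c0, c1, c2, c3, c4}" and hq: "q \<notin> {c0, c1, c2, c3, c4}"
      using p q W irr symE unfolding edge_type_def wheel5_def hole5_def by blast+
    have "\<not> E w p" using hub_not_adjacent[OF G cf W] p hp unfolding edge_type_def by blast
    moreover have "\<not> E w q"
      using hub_not_adjacent[OF G cf W1] q hq unfolding edge_type_def by blast
    moreover have "w \<noteq> p" "w \<noteq> q" "p \<noteq> q" using p q W unfolding edge_type_def wheel5_def by blast+
    ultimately show ?thesis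
      using claw_freeD[OF cf, of c1 w p q] p q W symE unfolding edge_type_def wheel5_def by blast
  qed
  have c1: "E p c1 \<and> E c1 p" if "p \<in> edge_type E c0 c1 c2 c3 c4 \<union> edge_type E c1 c2 c3 c4 c0" for p
    using that symE by (auto simp: edge_type_def)
  show ?thesis
    unfolding clique_def
  proof (intro ballI impI)
    fix u v
    assume u: "u \<in> insert c1 (edge_type E c0 c1 c2 c3 c4 \<union> edge_type E c1 c2 c3 c4 c0)"
      and v: "v \<in> insert c1 (edge_type E c0 c1 c2 c3 c4 \<union> edge_type E c1 c2 c3 c4 c0)" and "u \<noteq> v"
    then consider "u = c1" "v \<noteq> c1" | "v = c1" "u \<noteq> c1"
      | "u \<in> edge_type E c0 c1 c2 c3 c4" "v \<in> edge_type E c0 c1 c2 c3 c4"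
      | "u \<in> edge_type E c0 c1 c2 c3 c4" "v \<in> edge_type E c1 c2 c3 c4 c0"
      | "v \<in> edge_type E c0 c1 c2 c3 c4" "u \<in> edge_type E c1 c2 c3 c4 c0"
      | "u \<in> edge_type E c1 c2 c3 c4 c0" "v \<in> edge_type E c1 c2 c3 c4 c0"
      by blast
    then show "E u v"
    proof cases
      case 1 then show ?thesis using c1 v by blast
    next
      case 2 then show ?thesis using c1 u by blast
    next
      case 3 then show ?thesis using same[OF W] \<open>u \<noteq> v\<close> by blast
    next
      case 4 then show ?thesis by (rule cross)
    next
      case 5 then show ?thesis using cross[of v u] symE by blast
    next
      case 6 then show ?thesis using same[OF W1] \<open>u \<noteq> v\<close> by blast
    qed
  qed
qed

lemma perfect_no_connection:
  fixes E :: "'n::finite \<Rightarrow> 'n \<Rightarrow> bool"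
  assumes G: "simple_graph E" and cf: "claw_free E" and perf: "LS_plus_perfect E"
    and W: "wheel5 E w c0 c1 c2 c3 c4"
    and f: "f 0 \<in> edge_type E c0 c1 c2 c3 c4" "f m \<in> edge_type E c2 c3 c4 c0 c1"
      "\<forall>i. 0 < i \<and> i < m \<longrightarrow> f i \<in> remote E c0 c1 c2 c3 c4" "\<forall>i<m. E (f i) (f (Suc i))"
  shows False
proof -
  let ?A = "edge_type E c0 c1 c2 c3 c4" and ?B = "edge_type E c2 c3 c4 c0 c1"
    and ?Z = "remote E c0 c1 c2 c3 c4"
  have symE: "E u v \<longleftrightarrow> E v u" and irr: "\<not> E u u" for u v using G by (auto simp: simple_graph_def)
  have AB: "?A \<inter> ?B = {}" by (auto simp: edge_type_def)
  obtain p n where p: "p 0 \<in> ?A" "p n \<in> ?B" "\<And>i. 0 < i \<Longrightarrow> i < n \<Longrightarrow> p i \<in> ?Z" "0 < n"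
    "inj_on p {..n}" "\<And>i j. i \<le> n \<Longrightarrow> j \<le> n \<Longrightarrow> E (p i) (p j) \<longleftrightarrow> i = Suc j \<or> j = Suc i"
    by (rule shortest_connecting_path[OF symE irr AB f]) blast
  have cases: "i = 0 \<or> i = n \<or> p i \<in> ?Z" if "i \<le> n" for i
    using p(3)[of i] le_neq_implies_less[OF that] neq0_conv[of i] by blast
  have W2: "wheel5 E w c2 c3 c4 c0 c1" by (rule wheel5_rotate[OF wheel5_rotate[OF W]])
  have off: "p i \<notin> {c0, c1, c2, c3, c4}" if "i \<le> n" for i
    using cases[OF that] p(1,2) W symE irr
    unfolding edge_type_def remote_def wheel5_def hole5_def by blast
  have hole: "hole5 E c0 c1 c2 c3 c4" using W by (simp add: wheel5_def)
  have "\<not> E (p i) c4" if "i \<le> n" for i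
    using cases[OF that] p(1,2) unfolding edge_type_def remote_def by blast
  \<comment> \<open>Every node of the path misses two nonadjacent rim nodes, so the hub cannot see
    it without a claw.\<close>
  moreover have "\<not> E w (p i)" if "i \<le> n" for i
    using cases[OF that]
  proof (elim disjE)
    assume "i = n"
    then show ?thesis
      using hub_not_adjacent[OF G cf W2, of "p i"] p(2) off[OF that] by (simp add: edge_type_def)
  qed (use hub_not_adjacent[OF G cf W, of "p i"] p(1) off[OF that] in \<open>simp_all add: edge_type_def remote_def\<close>)
  moreover have "E (p i) c0 \<longleftrightarrow> i = 0" "E (p i) c1 \<longleftrightarrow> i = 0" if "i \<le> n" for i
    using cases[OF that] p(1,2,4) unfolding edge_type_def remote_def by auto
  moreover have "E (p i) c2 \<longleftrightarrow> i = n" "E (p i) c3 \<longleftrightarrow> i = n" if "i \<le> n" for i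
    using cases[OF that] p(1,2,4) unfolding edge_type_def remote_def by auto
  ultimately have "\<not> LS_plus_perfect E"
    using W symE unfolding wheel5_def
    by (intro path_imperfect[OF G hole, of w n p] p) auto
  then show False using perf by blast
qed

text \<open>Two rim edges coincide, meet, or are disjoint. The first two cases fall to the cliques,
  the last to the forbidden connection.\<close>

lemma perfect_attachments_adjacent:
  fixes E :: "'n::finite \<Rightarrow> 'n \<Rightarrow> bool"
  assumes G: "simple_graph E" and cf: "claw_free E" and perf: "LS_plus_perfect E"
    and W: "wheel5 E w c0 c1 c2 c3 c4"
    and p: "p \<in> edge_type E c0 c1 c2 c3 c4"
    and q: "q \<in> edge_type E c0 c1 c2 c3 c4 \<or> q \<in> edge_type E c1 c2 c3 c4 c0 \<or>
      q \<in> edge_type E c2 c3 c4 c0 c1 \<or> q \<in> edge_type E c3 c4 c0 c1 c2 \<or>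
      q \<in> edge_type E c4 c0 c1 c2 c3"
    and neq: "p \<noteq> q"
    and f: "f 0 = p" "f m = q" "\<forall>i. 0 < i \<and> i < m \<longrightarrow> f i \<in> remote E c0 c1 c2 c3 c4"
      "\<forall>i<m. E (f i) (f (Suc i))"
  shows "E p q"
proof -
  have symE: "E u v \<longleftrightarrow> E v u" for u v using G by (auto simp: simple_graph_def)
  have W1: "wheel5 E w c1 c2 c3 c4 c0" by (rule wheel5_rotate[OF W])
  have W2: "wheel5 E w c2 c3 c4 c0 c1" by (rule wheel5_rotate[OF W1])
  have W3: "wheel5 E w c3 c4 c0 c1 c2" by (rule wheel5_rotate[OF W2])
  have W4: "wheel5 E w c4 c0 c1 c2 c3" by (rule wheel5_rotate[OF W3])
  from q consider "q \<in> edge_type E c0 c1 c2 c3 c4 \<union> edge_type E c1 c2 c3 c4 c0"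
    | "q \<in> edge_type E c4 c0 c1 c2 c3" | "q \<in> edge_type E c2 c3 c4 c0 c1" | "q \<in> edge_type E c3 c4 c0 c1 c2"
    by blast
  then show ?thesis
  proof cases
    case 1
    then show ?thesis using edge_type_clique[OF G cf W] p neq unfolding clique_def by blast
  next
    case 2
    then show ?thesis using edge_type_clique[OF G cf W4] p neq unfolding clique_def by blast
  next
    case 3
    then show ?thesis using perfect_no_connection[OF G cf perf W, of f m] f p by blast
  next
    case 4
    \<comment> \<open>Here the disjoint edge lies on the other side. Numbering the rim from
      \<open>c3\<close> makes \<open>c0 c1\<close> the second edge of the pattern, so the walk must
      be reversed.\<close>
    have rem: "remote E c3 c4 c0 c1 c2 = remote E c0 c1 c2 c3 c4" by (auto simp: remote_def)
    have "\<forall>i. 0 < i \<and> i < m \<longrightarrow> f (m - i) \<in> remote E c3 c4 c0 c1 c2" using f(3) rem by simp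
    moreover have "\<forall>i<m. E (f (m - i)) (f (m - Suc i))"
    proof (intro allI impI)
      fix i assume "i < m"
      then have "E (f (m - Suc i)) (f (Suc (m - Suc i)))" "Suc (m - Suc i) = m - i" using f(4) by auto
      then show "E (f (m - i)) (f (m - Suc i))" using symE by simp
    qed
    ultimately show ?thesis
      using perfect_no_connection[OF G cf perf W3, of "\<lambda>i. f (m - i)" m] f(1,2) p 4 by simp
  qed
qed

section \<open>Remote nodes and stable sets of a graph with a 5-wheel\<close>

lemma card_le_3_of_three_cliques:
  fixes S :: "'n::finite set"
  assumes S: "stable_set E S" and Q: "clique E P" "clique E Q" "clique E R" and sub: "S \<subseteq> P \<union> Q \<union> R"
  shows "card S \<le> 3"
proof -
  have one: "card (S \<inter> K) \<le> 1" if "clique E K" for K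
    using S that unfolding card_le_Suc0_iff_eq[OF finite] One_nat_def stable_set_def clique_def by blast
  have "S \<inter> P \<union> S \<inter> Q \<union> S \<inter> R = S" using sub by blast
  then have "card S \<le> card (S \<inter> P) + card (S \<inter> Q) + card (S \<inter> R)"
    using card_Un_le[of "S \<inter> P \<union> S \<inter> Q" "S \<inter> R"] card_Un_le[of "S \<inter> P" "S \<inter> Q"] by simp
  then show ?thesis using one[OF Q(1)] one[OF Q(2)] one[OF Q(3)] by linarith
qed


text \<open>The nodes to which a component of the remote nodes is attached form a clique.\<close>

lemma perfect_remote_empty:
  fixes E :: "'n::finite \<Rightarrow> 'n \<Rightarrow> bool"
  assumes G: "simple_graph E" and cf: "claw_free E" and perf: "LS_plus_perfect E"
    and W: "wheel5 E w c0 c1 c2 c3 c4"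
    and nocut: "\<And>K L. clique E K \<Longrightarrow> L \<noteq> {} \<Longrightarrow> L \<inter> K = {} \<Longrightarrow>
      \<forall>u\<in>L. \<forall>v. E u v \<longrightarrow> v \<in> L \<union> K \<Longrightarrow> L \<union> K = UNIV"
  shows "remote E c0 c1 c2 c3 c4 = {}"
proof (rule ccontr)
  let ?Z = "remote E c0 c1 c2 c3 c4"
  assume "?Z \<noteq> {}"
  then obtain z where z: "z \<in> ?Z" by blast
  have symE: "E u v \<longleftrightarrow> E v u" and irr: "\<not> E u u" for u v using G by (auto simp: simple_graph_def)
  have W1: "wheel5 E w c1 c2 c3 c4 c0" by (rule wheel5_rotate[OF W])
  have W2: "wheel5 E w c2 c3 c4 c0 c1" by (rule wheel5_rotate[OF W1])
  have W3: "wheel5 E w c3 c4 c0 c1 c2" by (rule wheel5_rotate[OF W2])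
  have W4: "wheel5 E w c4 c0 c1 c2 c3" by (rule wheel5_rotate[OF W3])
  have hole: "hole5 E c0 c1 c2 c3 c4" using W by (simp add: wheel5_def)
  define r where "r = {(u, v). E u v \<and> u \<in> ?Z \<and> v \<in> ?Z}"
  define L where "L = {y. (z, y) \<in> r\<^sup>*}"
  define K where "K = {p. p \<notin> ?Z \<and> (\<exists>y\<in>L. E y p)}"
  have LZ: "L \<subseteq> ?Z"
  proof
    fix y assume "y \<in> L"
    then have "(z, y) \<in> r\<^sup>*" by (simp add: L_def)
    then show "y \<in> ?Z" by (cases rule: rtranclE) (use z in \<open>auto simp: r_def\<close>)
  qed
  have zL: "z \<in> L" by (simp add: L_def)
  have closed: "v \<in> L \<union> K" if "u \<in> L" "E u v" for u v
  proof (cases "v \<in> ?Z")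
    case True
    then have "(u, v) \<in> r" using that LZ by (auto simp: r_def)
    then show ?thesis using that(1) by (auto simp: L_def)
  next
    case False
    then show ?thesis using that by (auto simp: K_def)
  qed
  have off: "y \<notin> {c0, c1, c2, c3, c4}" if "y \<in> ?Z" for y
    using that hole symE unfolding remote_def hole5_def by blast
  have Ktypes: "p \<in> edge_type E c0 c1 c2 c3 c4 \<or> p \<in> edge_type E c1 c2 c3 c4 c0 \<or>
      p \<in> edge_type E c2 c3 c4 c0 c1 \<or> p \<in> edge_type E c3 c4 c0 c1 c2 \<or>
      p \<in> edge_type E c4 c0 c1 c2 c3" if pK: "p \<in> K" for p
  proof -
    obtain y where y: "y \<in> ?Z" "E y p" using pK LZ by (auto simp: K_def)
    have pC: "p \<notin> {c0, c1, c2, c3, c4}" using y unfolding remote_def by blast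
    \<comment> \<open>A node seeing the whole rim is itself the hub of a wheel on that rim, and hubs
      see no remote node.\<close>
    have "p \<notin> hubs E c0 c1 c2 c3 c4"
    proof
      assume "p \<in> hubs E c0 c1 c2 c3 c4"
      then have "wheel5 E p c0 c1 c2 c3 c4" using hole by (simp add: wheel5_def hubs_def)
      then have "\<not> E p y" using hub_not_adjacent[OF G cf, of p c0 c1 c2 c3 c4 y] y(1) off[OF y(1)]
        by (simp add: remote_def)
      then show False using y(2) symE by blast
    qed
    moreover have "p \<notin> ?Z" using pK by (simp add: K_def)
    ultimately show ?thesis using wheel_types[OF G cf perf hole pC] by blast
  qed
  have walk: "\<exists>f m. f 0 = p \<and> f m = q \<and> (\<forall>i. 0 < i \<and> i < m \<longrightarrow> f i \<in> ?Z) \<and> (\<forall>i<m. E (f i) (f (Suc i)))"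
    if "p \<in> K" "q \<in> K" for p q
  proof -
    obtain y y' where y: "y \<in> L" "E y p" "y' \<in> L" "E y' q" using \<open>p \<in> K\<close> \<open>q \<in> K\<close> by (auto simp: K_def)
    have "sym r" using symE by (auto simp: r_def sym_def)
    then have "(y, z) \<in> r\<^sup>*" using y(1) sym_rtrancl unfolding L_def sym_def by blast
    then have "(y, y') \<in> r\<^sup>*" using y(3) unfolding L_def by auto
    then obtain k where "(y, y') \<in> r ^^ k" using rtrancl_power by blast
    then obtain g where g: "g 0 = y" "g k = y'" "\<forall>i<k. (g i, g (Suc i)) \<in> r"
      using relpow_fun_conv[of y y' k r] by blast
    have gZ: "g i \<in> ?Z" if "i \<le> k" for i
    proof (cases "i = k")
      case True then show ?thesis using g y LZ by auto
    next
      case False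
      then have "(g i, g (Suc i)) \<in> r" using g that by simp
      then show ?thesis by (simp add: r_def)
    qed
    define f where "f i = (if i = 0 then p else if i \<le> Suc k then g (i - 1) else q)" for i
    have "f i \<in> ?Z" if "0 < i" "i < Suc (Suc k)" for i
      using that gZ[of "i - 1"] by (auto simp: f_def)
    moreover have "E (f i) (f (Suc i))" if ik: "i < Suc (Suc k)" for i
    proof -
      consider "i = 0" | "i = Suc k" | j where "i = Suc j" "j < k"
        using ik by (cases i) (auto simp: less_Suc_eq)
      then show ?thesis
      proof cases
        case 1 then show ?thesis using g(1) y(2) symE by (simp add: f_def)
      next
        case 2 then show ?thesis using g(2) y(4) by (simp add: f_def)
      next
        case (3 j)
        then have "(g j, g (Suc j)) \<in> r" using g(3) by blast
        then show ?thesis using 3 by (simp add: f_def r_def)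
      qed
    qed
    moreover have "f 0 = p" "f (Suc (Suc k)) = q" by (simp_all add: f_def)
    ultimately show ?thesis by blast
  qed
  have "clique E K"
    unfolding clique_def
  proof (intro ballI impI)
    fix p q assume p: "p \<in> K" and q: "q \<in> K" and neq: "p \<noteq> q"
    obtain f m where f: "f 0 = p" "f m = q" "\<forall>i. 0 < i \<and> i < m \<longrightarrow> f i \<in> ?Z" "\<forall>i<m. E (f i) (f (Suc i))"
      using walk[OF p q] by blast
    have rem: "remote E c1 c2 c3 c4 c0 = ?Z" "remote E c2 c3 c4 c0 c1 = ?Z"
      "remote E c3 c4 c0 c1 c2 = ?Z" "remote E c4 c0 c1 c2 c3 = ?Z" by (auto simp: remote_def)
    note adj = perfect_attachments_adjacent[OF G cf perf _ _ _ neq f(1,2) _ f(4)]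
    show "E p q"
      using Ktypes[OF p]
    proof (elim disjE)
      assume t: "p \<in> edge_type E c0 c1 c2 c3 c4"
      show ?thesis by (rule adj[OF W t _ f(3)]) (use Ktypes[OF q] in blast)
    next
      assume t: "p \<in> edge_type E c1 c2 c3 c4 c0"
      show ?thesis by (rule adj[OF W1 t _ f(3)[folded rem(1)]]) (use Ktypes[OF q] in blast)
    next
      assume t: "p \<in> edge_type E c2 c3 c4 c0 c1"
      show ?thesis by (rule adj[OF W2 t _ f(3)[folded rem(2)]]) (use Ktypes[OF q] in blast)
    next
      assume t: "p \<in> edge_type E c3 c4 c0 c1 c2"
      show ?thesis by (rule adj[OF W3 t _ f(3)[folded rem(3)]]) (use Ktypes[OF q] in blast)
    next
      assume t: "p \<in> edge_type E c4 c0 c1 c2 c3"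
      show ?thesis by (rule adj[OF W4 t _ f(3)[folded rem(4)]]) (use Ktypes[OF q] in blast)
    qed
  qed
  moreover have "L \<inter> K = {}" using LZ by (auto simp: K_def)
  moreover have "L \<noteq> {}" using zL by blast
  ultimately have "L \<union> K = UNIV" using nocut closed by blast
  \<comment> \<open>\<open>c0\<close> is neither remote nor adjacent to a remote node.\<close>
  then have "c0 \<in> L \<union> K" by blast
  then show False
    using off LZ z unfolding K_def by (force simp: remote_def)
qed

text \<open>Stability against \<open>c0\<close> removes \<open>c1\<close>, \<open>c4\<close>, the
  hubs and the two types at \<open>c0\<close>; the rest is covered by the cliques around
  \<open>c2\<close> and \<open>c3\<close>.\<close>

lemma wheel_stable_at_rim:
  fixes E :: "'n::finite \<Rightarrow> 'n \<Rightarrow> bool"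
  assumes G: "simple_graph E" and cf: "claw_free E" and perf: "LS_plus_perfect E"
    and W: "wheel5 E w c0 c1 c2 c3 c4" and Z: "remote E c0 c1 c2 c3 c4 = {}"
    and S: "stable_set E S" "c0 \<in> S"
  shows "card S \<le> 3"
proof -
  have symE: "E u v \<longleftrightarrow> E v u" for u v using G by (auto simp: simple_graph_def)
  have W1: "wheel5 E w c1 c2 c3 c4 c0" by (rule wheel5_rotate[OF W])
  have W2: "wheel5 E w c2 c3 c4 c0 c1" by (rule wheel5_rotate[OF W1])
  have hole: "hole5 E c0 c1 c2 c3 c4" using W by (simp add: wheel5_def)
  have c0: "clique E {c0}" by (simp add: clique_def)
  have "S \<subseteq> {c0} \<union> insert c2 (edge_type E c1 c2 c3 c4 c0 \<union> edge_type E c2 c3 c4 c0 c1)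
      \<union> insert c3 (edge_type E c2 c3 c4 c0 c1 \<union> edge_type E c3 c4 c0 c1 c2)"
  proof
    fix x assume "x \<in> S"
    then have "\<not> E x c0" using S unfolding stable_set_def by blast
    then show "x \<in> {c0} \<union> insert c2 (edge_type E c1 c2 c3 c4 c0 \<union> edge_type E c2 c3 c4 c0 c1)
        \<union> insert c3 (edge_type E c2 c3 c4 c0 c1 \<union> edge_type E c3 c4 c0 c1 c2)"
      using wheel_types[OF G cf perf hole, of x] Z hole symE
      unfolding hubs_def edge_type_def hole5_def by blast
  qed
  then show ?thesis
    by (rule card_le_3_of_three_cliques[OF S(1) c0 edge_type_clique[OF G cf W1] edge_type_clique[OF G cf W2]])
qed

text \<open>\<open>p\<close> sees all nodes whose edge coincides with or meets its own. The opposite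
  types lie in the clique around \<open>c3\<close>, and the hubs form a clique because two
  nonadjacent ones and \<open>p\<close> would be a claw at \<open>c0\<close>.\<close>

lemma wheel_stable_at_edge_type:
  fixes E :: "'n::finite \<Rightarrow> 'n \<Rightarrow> bool"
  assumes G: "simple_graph E" and cf: "claw_free E" and perf: "LS_plus_perfect E"
    and W: "wheel5 E w c0 c1 c2 c3 c4" and Z: "remote E c0 c1 c2 c3 c4 = {}"
    and S: "stable_set E S" "S \<inter> {c0, c1, c2, c3, c4} = {}"
    and p: "p \<in> S" "p \<in> edge_type E c0 c1 c2 c3 c4"
  shows "card S \<le> 3"
proof -
  have symE: "E u v \<longleftrightarrow> E v u" and irr: "\<not> E u u" for u v using G by (auto simp: simple_graph_def)
  have W1: "wheel5 E w c1 c2 c3 c4 c0" by (rule wheel5_rotate[OF W])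
  have W2: "wheel5 E w c2 c3 c4 c0 c1" by (rule wheel5_rotate[OF W1])
  have W3: "wheel5 E w c3 c4 c0 c1 c2" by (rule wheel5_rotate[OF W2])
  have W4: "wheel5 E w c4 c0 c1 c2 c3" by (rule wheel5_rotate[OF W3])
  have hole: "hole5 E c0 c1 c2 c3 c4" using W by (simp add: wheel5_def)
  have far: "\<not> E h p" if "h \<in> hubs E c0 c1 c2 c3 c4" for h
  proof (rule hub_not_adjacent[OF G cf, of h c0 c1 c2 c3 c4])
    show "wheel5 E h c0 c1 c2 c3 c4" using that hole by (simp add: wheel5_def hubs_def)
  qed (use p S(2) in \<open>auto simp: edge_type_def\<close>)
  have hubs: "clique E (hubs E c0 c1 c2 c3 c4)"
    unfolding clique_def
  proof (intro ballI impI)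
    fix h k assume hk: "h \<in> hubs E c0 c1 c2 c3 c4" "k \<in> hubs E c0 c1 c2 c3 c4" "h \<noteq> k"
    have "h \<noteq> p" "k \<noteq> p" using hk p unfolding hubs_def edge_type_def by blast+
    then show "E h k"
      using claw_freeD[OF cf, of c0 h k p] far[OF hk(1)] far[OF hk(2)] hk p(2) symE
      unfolding hubs_def edge_type_def by blast
  qed
  have near: "E p y" if "y \<in> edge_type E c0 c1 c2 c3 c4 \<or> y \<in> edge_type E c1 c2 c3 c4 c0 \<or>
      y \<in> edge_type E c4 c0 c1 c2 c3" "y \<noteq> p" for y
  proof (cases "y \<in> edge_type E c4 c0 c1 c2 c3")
    case True
    then show ?thesis
      using cliqueD[OF edge_type_clique[OF G cf W4], of p y] p(2) \<open>y \<noteq> p\<close> by blast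
  next
    case False
    then show ?thesis
      using cliqueD[OF edge_type_clique[OF G cf W], of p y] p(2) that by blast
  qed
  have pp: "clique E {p}" by (simp add: clique_def)
  have "S \<subseteq> {p} \<union> insert c3 (edge_type E c2 c3 c4 c0 c1 \<union> edge_type E c3 c4 c0 c1 c2)
      \<union> hubs E c0 c1 c2 c3 c4"
  proof
    fix x assume x: "x \<in> S"
    then have "\<not> E p x" using S p unfolding stable_set_def by blast
    moreover have "x \<notin> {c0, c1, c2, c3, c4}" using x S(2) by blast
    ultimately show "x \<in> {p} \<union> insert c3 (edge_type E c2 c3 c4 c0 c1 \<union> edge_type E c3 c4 c0 c1 c2)
        \<union> hubs E c0 c1 c2 c3 c4"
      using wheel_types[OF G cf perf hole, of x] Z near[of x] by blast
  qed
  then show ?thesis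
    by (rule card_le_3_of_three_cliques[OF S(1) pp edge_type_clique[OF G cf W2] hubs])
qed

lemma perfect_wheel_stability:
  fixes E :: "'n::finite \<Rightarrow> 'n \<Rightarrow> bool"
  assumes G: "simple_graph E" and cf: "claw_free E" and perf: "LS_plus_perfect E"
    and W: "wheel5 E w c0 c1 c2 c3 c4" and Z: "remote E c0 c1 c2 c3 c4 = {}"
    and S: "stable_set E S"
  shows "card S \<le> 3"
proof -
  have symE: "E u v \<longleftrightarrow> E v u" for u v using G by (auto simp: simple_graph_def)
  have W1: "wheel5 E w c1 c2 c3 c4 c0" by (rule wheel5_rotate[OF W])
  have W2: "wheel5 E w c2 c3 c4 c0 c1" by (rule wheel5_rotate[OF W1])
  have W3: "wheel5 E w c3 c4 c0 c1 c2" by (rule wheel5_rotate[OF W2])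
  have W4: "wheel5 E w c4 c0 c1 c2 c3" by (rule wheel5_rotate[OF W3])
  have hole: "hole5 E c0 c1 c2 c3 c4" using W by (simp add: wheel5_def)
  have Zs: "remote E c1 c2 c3 c4 c0 = {}" "remote E c2 c3 c4 c0 c1 = {}"
    "remote E c3 c4 c0 c1 c2 = {}" "remote E c4 c0 c1 c2 c3 = {}" using Z by (auto simp: remote_def)
  note rim = wheel_stable_at_rim[OF G cf perf W Z S] wheel_stable_at_rim[OF G cf perf W1 Zs(1) S]
    wheel_stable_at_rim[OF G cf perf W2 Zs(2) S] wheel_stable_at_rim[OF G cf perf W3 Zs(3) S]
    wheel_stable_at_rim[OF G cf perf W4 Zs(4) S]
  show ?thesis
  proof (cases "S \<inter> {c0, c1, c2, c3, c4} = {}")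
    case False
    then show ?thesis using rim by blast
  next
    case True
    have perm: "S \<inter> {c1, c2, c3, c4, c0} = {}" "S \<inter> {c2, c3, c4, c0, c1} = {}"
      "S \<inter> {c3, c4, c0, c1, c2} = {}" "S \<inter> {c4, c0, c1, c2, c3} = {}" using True by auto
    note types = wheel_stable_at_edge_type[OF G cf perf W Z S True]
      wheel_stable_at_edge_type[OF G cf perf W1 Zs(1) S perm(1)]
      wheel_stable_at_edge_type[OF G cf perf W2 Zs(2) S perm(2)]
      wheel_stable_at_edge_type[OF G cf perf W3 Zs(3) S perm(3)]
      wheel_stable_at_edge_type[OF G cf perf W4 Zs(4) S perm(4)]
    show ?thesis
    proof (cases "S \<subseteq> hubs E c0 c1 c2 c3 c4")
      case True
      have "card S \<le> 2"
      proof (rule card_le_2_of_no_triple)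
        fix a b c assume "a \<in> S" "b \<in> S" "c \<in> S" "a \<noteq> b" "a \<noteq> c" "b \<noteq> c"
        moreover from this have "E c0 a" "E c0 b" "E c0 c" using True symE unfolding hubs_def by blast+
        ultimately show False
          using claw_freeD[OF cf, of c0 a b c] S unfolding stable_set_def by blast
      qed
      then show ?thesis by simp
    next
      case False
      then obtain x where x: "x \<in> S" "x \<notin> hubs E c0 c1 c2 c3 c4" by blast
      then have "x \<notin> {c0, c1, c2, c3, c4}" using True by blast
      from wheel_types[OF G cf perf hole this] show ?thesis
        using types x Z by blast
    qed
  qed
qed

theorem theorem8:
  fixes E :: "'n::finite \<Rightarrow> 'n \<Rightarrow> bool"
  assumes "simple_graph E"
    and "claw_free E"
    and "\<not> quasi_line E"
    and "stability_number E \<ge> 4"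
    and "facet_defining E"
  shows "\<not> LS_plus_perfect E"
proof
  assume perf: "LS_plus_perfect E"
  note G = assms(1) and cf = assms(2)
  have nocut: "L \<union> K = UNIV" if "clique E K" "L \<noteq> {}" "L \<inter> K = {}"
    "\<forall>u\<in>L. \<forall>v. E u v \<longrightarrow> v \<in> L \<union> K" for K L
    using facet_defining_no_clique_cutset[OF G assms(5) that(1,2,3)] that(4) by blast
  have "stability_number E \<in> card ` {S. stable_set E S}"
    unfolding stability_number_def by (rule Max_in) (auto simp: stable_set_def)
  then obtain T where T: "stable_set E T" "4 \<le> card T" using assms(4) by auto
  then obtain S where "S \<subseteq> T" and card: "card S = 4" by (meson obtain_subset_with_card_n)
  then have S: "stable_set E S" using T(1) unfolding stable_set_def by blast
  obtain v n h where h: "odd n" "5 \<le> n" "antihole E n h" "\<forall>a. E v (h a)"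
    using not_quasi_line_antihole[OF G cf assms(3)] by blast
  have "\<not> 7 \<le> n"
  proof
    assume "7 \<le> n"
    moreover have "\<forall>Z. Z \<noteq> {} \<longrightarrow> (\<forall>u\<in>Z. \<forall>v. E u v \<longrightarrow> v \<in> Z) \<longrightarrow> Z = UNIV"
      \<comment> \<open>The empty clique as cutset: the graph is connected.\<close>
      using nocut[of "{}"] by (simp add: clique_def)
    ultimately show False using no_large_antihole[OF G cf h(3) _ h(1) _ S card] by blast
  qed
  then have "n = 5" using h(1,2) by presburger
  then have h5: "antihole E 5 h" using h(3) by simp
  have symE: "E u v = E v u" for u v using G by (auto simp: simple_graph_def)
  have nonadj: "\<not> E (h a) (h (Suc a))" for a using h5 by (simp add: antihole_def)
  have "h 5 = h 0" using h5 unfolding antihole_def by (metis add_0)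
  \<comment> \<open>The complement of a 5-cycle is a 5-cycle, traversed in steps of two.\<close>
  then have "hole5 E (h 0) (h 2) (h 4) (h 1) (h 3)"
    using nonadj[of 0] nonadj[of 1] nonadj[of 2] nonadj[of 3] nonadj[of 4] symE
      antihole_adj[OF h5, of 0 2] antihole_adj[OF h5, of 2 4] antihole_adj[OF h5, of 1 4]
      antihole_adj[OF h5, of 1 3] antihole_adj[OF h5, of 0 3]
    by (simp add: hole5_def numeral_eq_Suc)
  then have W: "wheel5 E v (h 0) (h 2) (h 4) (h 1) (h 3)" using h(4) by (simp add: wheel5_def)
  have "remote E (h 0) (h 2) (h 4) (h 1) (h 3) = {}"
    by (rule perfect_remote_empty[OF G cf perf W]) (rule nocut)
  from perfect_wheel_stability[OF G cf perf W this S] show False using card by simp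
qed

end
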